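(* Let $\mathfrak g$ be a finite-dimensional Lie algebra over $K$ and let $\theta$ be an action of $\mathfrak g$ on $K[t]$ of Type 3. Let $L$ be the kernel of $\theta:K[t]\otimes\mathfrak g\to K[t]$. Then there is a one-to-one correspondence between Lie Rinehart bialgebras $(K[t]\otimes\mathfrak g,d_* )$ on the crossed product $K[t]\otimes\mathfrak g$ and equivalence classes of compatible pairs $(\Lambda,\Omega)$, where $\Lambda\in K[t]\otimes\wedge^2\mathfrak g$ and $\Omega:\mathfrak g\to L\wedge_{K[t]}L$, such that $$d_*=[\Lambda,\cdot]+\Omega .$$
   Context: $K=\mathbb R$ or $\mathbb C$. $\operatorname{Der}K[t]$ is identified with $K[t]$ via $f\leftrightarrow f\frac d{dt}$ (bracket $[f,g]=fg'-f'g$). An action of $\mathfrak g$ on $K[t]$ is a Lie algebra morphism $\theta:\mathfrak g\to K[t]$. It is of Type 3 if $\dim_K\theta(\mathfrak g)=3$; it is known that then, with $\mathfrak g=\operatorname{Rad}\mathfrak g\rtimes\mathfrak m$ a Levi decomposition, $\mathfrak m=\mathfrak s\oplus\mathfrak m_0$ with $\mathfrak s\cong\mathfrak{sl}(2,K)$, $\mathfrak m_0$ semisimple, $\operatorname{Ker}(\theta|_{\mathfrak g})=\operatorname{Rad}\mathfrak g\rtimes\mathfrak m_0$, and $\mathfrak s$ has a basis $X_0,X_1,X_2$ with $\theta(X_i)=t^i$. A Lie Rinehart algebra over a commutative unital $K$-algebra $A$ is an $A$-module $E$ that is a $K$-Lie algebra with an anchor $\theta:E\to\operatorname{Der}A$,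 a morphism of Lie algebras and $A$-modules, with $[x,ay]=a[x,y]+\theta(x)(a)y$. The crossed product $K[t]\otimes\mathfrak g$ is the Lie Rinehart algebra over $A=K[t]$ with anchor the $K[t]$-linear extension of $\theta$ and bracket $[aX,bY]=ab[X,Y]+a(\theta(X)b)Y-b(\theta(Y)a)X$. The Schouten bracket on $\wedge_A^\bullet E$ (with $\wedge^0_AE=A$, $[\wedge^k,\wedge^l]\subset\wedge^{k+l-1}$) is the $K$-bilinear graded Lie bracket ($[x,y]=-(-1)^{(|x|-1)(|y|-1)}[y,x]$) extending the bracket of $E$, with $[x,f]=\theta(x)f$ for $x\in E,f\in A$, and $[x,y\wedge z]=[x,y]\wedge z+(-1)^{(|x|-1)|y|}y\wedge[x,z]$. For $E=K[t]\otimes\mathfrak g$, $\wedge^k_{K[t]}E=K[t]\otimes\wedge^k\mathfrak g$. A Lie Rinehart bialgebra $(E,\sigma)$ is a Lie Rinehart algebra $E$ with a $K$-linear operator $\sigma:\wedge^k_AE\to\wedge^{k+1}_AE$ ($k\ge0$) such that $\sigma(x\wedge y)=\sigma x\wedge y+(-1)^{|x|}x\wedge\sigma y$, $\sigma^2=0$, and $\sigma[x,y]=[\sigma x,y]+(-1)^{|x|+1}[x,\sigma y]$ for all $x\in\wedge_A^{|x|}E$, $y\in\wedge_A^\bullet E$. A $K$-linear map $\Omega:\mathfrak g\to L\wedge_{K[t]}L$ is a $1$-cocycle if $\Omega[X,Y]=[\Omega(X),Y]+[X,\Omega(Y)]$ for all $X,Y\in\mathfrak g$. It is extended to $\Omega:K[t]\otimes\wedge^k\mathfrak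 g\to K[t]\otimes\wedge^{k+1}\mathfrak g$ by $\Omega=0$ for $k=0$, $\Omega(fX)=f\Omega(X)$ for $k=1$, and $\Omega(u_1\wedge\cdots\wedge u_k)=\sum_i(-1)^{i+1}u_1\wedge\cdots\wedge\Omega(u_i)\wedge\cdots\wedge u_k$. A pair $(\Lambda,\Omega)$, with $\Lambda\in K[t]\otimes\wedge^2\mathfrak g$ and $\Omega:\mathfrak g\to L\wedge_{K[t]}L$ $K$-linear, is compatible if $\Omega$ is a $1$-cocycle and $[\frac12[\Lambda,\Lambda]+\Omega(\Lambda),\cdot]+\Omega^2=0$ as a map $K[t]\otimes\mathfrak g\to K[t]\otimes\wedge^3\mathfrak g$. Compatible pairs $(\Lambda,\Omega)$ and $(\Lambda',\Omega')$ are equivalent if there is $\nu\in L\wedge_{K[t]}L$ with $\Lambda'=\Lambda+\nu$ and $\Omega'=\Omega-[\nu,\cdot]$. *)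

theory Defs
  imports "HOL-Analysis.Finite_Cartesian_Product" "HOL-Computational_Algebra.Polynomial" Complex_Main
begin

section \<open>The ground field\<close>

text \<open>The fields of this class are exactly the isomorphic copies of the real and of the complex
  numbers.\<close>

class real_or_complex = field +
  assumes real_or_complex:
    "(\<exists>h :: 'a \<Rightarrow> real. bij h \<and> h 1 = 1 \<and> (\<forall>x y. h (x + y) = h x + h y \<and> h (x * y) = h x * h y)) \<or>
     (\<exists>h :: 'a \<Rightarrow> complex. bij h \<and> h 1 = 1 \<and> (\<forall>x y. h (x + y) = h x + h y \<and> h (x * y) = h x * h y))"

instance real :: real_or_complex
  by standard (rule disjI1, rule exI[of _ id], simp)

instance complex :: real_or_complex
  by standard (rule disjI2, rule exI[of _ id], simp)

instance real_or_complex \<subseteq> field_char_0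
proof
  have hom_of_nat: "h (of_nat n) = of_nat n"
    if "h 1 = 1" and add: "\<forall>x y. h (x + y) = h x + h y"
    for h :: "'a \<Rightarrow> 'b::field_char_0" and n
  proof (induction n)
    case 0
    have "h 0 + h 0 = h 0 + 0" using add by (metis add.right_neutral)
    then have "h 0 = 0" by (rule add_left_imp_eq)
    then show ?case by simp
  next
    case (Suc n)
    then show ?case using that by simp
  qed
  show "inj (of_nat :: nat \<Rightarrow> 'a)"
    using real_or_complex[where 'a = 'a]
  proof (elim disjE exE conjE)
    fix h :: "'a \<Rightarrow> real"
    assume "h 1 = 1" "\<forall>x y. h (x + y) = h x + h y \<and> h (x * y) = h x * h y"
    then show ?thesis using hom_of_nat[of h] by (metis injI of_nat_eq_iff)
  next
    fix h :: "'a \<Rightarrow> complex"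
    assume "h 1 = 1" "\<forall>x y. h (x + y) = h x + h y \<and> h (x * y) = h x * h y"
    then show ?thesis using hom_of_nat[of h] by (metis injI of_nat_eq_iff)
  qed
qed


section \<open>Lie algebras and Lie Rinehart algebras\<close>

locale lie_algebra = vector_space scale
  for scale :: "'k::field \<Rightarrow> 'g::ab_group_add \<Rightarrow> 'g" +
  fixes bracket :: "'g \<Rightarrow> 'g \<Rightarrow> 'g"
  assumes bracket_add_left: "bracket (x + y) z = bracket x z + bracket y z"
    and bracket_add_right: "bracket x (y + z) = bracket x y + bracket x z"
    and bracket_scale_left: "bracket (scale c x) y = scale c (bracket x y)"
    and bracket_scale_right: "bracket x (scale c y) = scale c (bracket x y)"
    and bracket_self: "bracket x x = 0"
    and jacobi: "bracket x (bracket y z) + bracket y (bracket z x) + bracket z (bracket x y) = 0"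

text \<open>A commutative unital algebra over a field is a commutative ring with a compatible scalar
  action \<open>scaleA\<close>.\<close>

locale comm_algebra = vector_space scaleA
  for scaleA :: "'k::field \<Rightarrow> 'a::comm_ring_1 \<Rightarrow> 'a" +
  assumes scaleA_mult: "scaleA c (a * b) = scaleA c a * b"

definition derivation :: "('k::field \<Rightarrow> 'a::comm_ring_1 \<Rightarrow> 'a) \<Rightarrow> ('a \<Rightarrow> 'a) \<Rightarrow> bool"
  where "derivation scaleA D \<longleftrightarrow>
    Vector_Spaces.linear scaleA scaleA D \<and> (\<forall>a b. D (a * b) = D a * b + a * D b)"

locale lie_rinehart_algebra =
  alg: comm_algebra scaleA +
  mod: module act +
  lie: lie_algebra "\<lambda>c. act (scaleA c 1)" bracket
  for scaleA :: "'k::field \<Rightarrow> 'a::comm_ring_1 \<Rightarrow> 'a"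
    and act :: "'a \<Rightarrow> 'e::ab_group_add \<Rightarrow> 'e"
    and bracket :: "'e \<Rightarrow> 'e \<Rightarrow> 'e" +
  fixes anchor :: "'e \<Rightarrow> 'a \<Rightarrow> 'a"
  assumes anchor_derivation: "derivation scaleA (anchor x)"
    and anchor_add: "anchor (x + y) a = anchor x a + anchor y a"
    and anchor_act: "anchor (act b x) a = b * anchor x a"
    and anchor_bracket: "anchor (bracket x y) a = anchor x (anchor y a) - anchor y (anchor x a)"
    and bracket_act: "bracket x (act a y) = act a (bracket x y) + act (anchor x a) y"


section \<open>The exterior algebra of a free module with an ordered basis\<close>

text \<open>The free \<open>A\<close>-module on a finite linearly ordered set \<open>I\<close> is \<open>A ^ I\<close>. Its exterior algebra
  over \<open>A\<close> is the Grassmann algebra: the free \<open>A\<close>-module on the subsets of \<open>I\<close>, the basis vector of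
  \<open>S = {i\<^sub>1 < \<dots> < i\<^sub>k}\<close> standing for \<open>e\<^bsub>i\<^sub>1\<^esub> \<and> \<dots> \<and> e\<^bsub>i\<^sub>k\<^esub>\<close>.\<close>

type_synonym ('a, 'i) ext = "('a, 'i set) vec"

text \<open>For disjoint \<open>S\<close> and \<open>T\<close>, this is the sign of the permutation that sorts the elements of \<open>S\<close>
  followed by those of \<open>T\<close>.\<close>

definition shuffle_sign :: "'i::linorder set \<Rightarrow> 'i set \<Rightarrow> 'a::comm_ring_1"
  where "shuffle_sign S T = (- 1) ^ card {(i, j). i \<in> S \<and> j \<in> T \<and> j < i}"

definition wedge ::
    "('a::comm_ring_1, 'i::{finite,linorder}) ext \<Rightarrow> ('a, 'i) ext \<Rightarrow> ('a, 'i) ext"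
    (infixl \<open>\<^bold>\<and>\<close> 71)
  where "x \<^bold>\<and> y = (\<chi> S. \<Sum>T\<in>Pow S. shuffle_sign T (S - T) * x $ T * y $ (S - T))"

definition ext0 :: "'a::comm_ring_1 \<Rightarrow> ('a, 'i::{finite,linorder}) ext"
  where "ext0 a = axis {} a"

definition ext1 :: "('a::comm_ring_1, 'i::{finite,linorder}) vec \<Rightarrow> ('a, 'i) ext"
  where "ext1 u = (\<Sum>i\<in>UNIV. axis {i} (u $ i))"

definition ext_grade :: "nat \<Rightarrow> ('a::comm_ring_1, 'i::{finite,linorder}) ext set"
  where "ext_grade k = {x. \<forall>S. x $ S \<noteq> 0 \<longrightarrow> card S = k}"


section \<open>The Schouten bracket and Lie Rinehart bialgebras\<close>

text \<open>Signs \<open>(- 1) ^ (k - 1)\<close> are written as \<open>(- 1) ^ (k + 1)\<close>, because \<open>k\<close> may be \<open>0\<close>.\<close>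

definition is_schouten ::
    "('k::field \<Rightarrow> 'a::comm_ring_1 \<Rightarrow> 'a) \<Rightarrow>
     (('a, 'i::{finite,linorder}) vec \<Rightarrow> ('a, 'i) vec \<Rightarrow> ('a, 'i) vec) \<Rightarrow> (('a, 'i) vec \<Rightarrow> 'a \<Rightarrow> 'a) \<Rightarrow>
     (('a, 'i) ext \<Rightarrow> ('a, 'i) ext \<Rightarrow> ('a, 'i) ext) \<Rightarrow> bool"
  where "is_schouten scaleA bracket anchor sch \<longleftrightarrow>
    (\<forall>x y z. sch (x + y) z = sch x z + sch y z) \<and>
    (\<forall>x y z. sch x (y + z) = sch x y + sch x z) \<and>
    (\<forall>c x y. sch (scaleA c 1 *s x) y = scaleA c 1 *s sch x y) \<and>
    (\<forall>c x y. sch x (scaleA c 1 *s y) = scaleA c 1 *s sch x y) \<and>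
    (\<forall>x\<in>ext_grade 0. \<forall>y\<in>ext_grade 0. sch x y = 0) \<and>
    (\<forall>k l. k + l \<ge> 1 \<longrightarrow>
      (\<forall>x\<in>ext_grade k. \<forall>y\<in>ext_grade l. sch x y \<in> ext_grade (k + l - 1))) \<and>
    (\<forall>k l. \<forall>x\<in>ext_grade k. \<forall>y\<in>ext_grade l.
      sch x y = - ((- 1) ^ ((k + 1) * (l + 1)) *s sch y x)) \<and>
    (\<forall>k l. \<forall>x\<in>ext_grade k. \<forall>y\<in>ext_grade l. \<forall>z.
      sch x (sch y z) = sch (sch x y) z + (- 1) ^ ((k + 1) * (l + 1)) *s sch y (sch x z)) \<and>
    (\<forall>k l. \<forall>x\<in>ext_grade k. \<forall>y\<in>ext_grade l. \<forall>z.
      sch x (y \<^bold>\<and> z) = sch x y \<^bold>\<and> z + (- 1) ^ ((k + 1) * l) *s (y \<^bold>\<and> sch x z)) \<and>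
    (\<forall>u v. sch (ext1 u) (ext1 v) = ext1 (bracket u v)) \<and>
    (\<forall>u a. sch (ext1 u) (ext0 a) = ext0 (anchor u a))"

definition schouten ::
    "('k::field \<Rightarrow> 'a::comm_ring_1 \<Rightarrow> 'a) \<Rightarrow>
     (('a, 'i::{finite,linorder}) vec \<Rightarrow> ('a, 'i) vec \<Rightarrow> ('a, 'i) vec) \<Rightarrow> (('a, 'i) vec \<Rightarrow> 'a \<Rightarrow> 'a) \<Rightarrow>
     ('a, 'i) ext \<Rightarrow> ('a, 'i) ext \<Rightarrow> ('a, 'i) ext"
  where "schouten scaleA bracket anchor = (THE sch. is_schouten scaleA bracket anchor sch)"

definition lie_rinehart_bialgebra ::
    "('k::field \<Rightarrow> 'a::comm_ring_1 \<Rightarrow> 'a) \<Rightarrow>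
     (('a, 'i::{finite,linorder}) vec \<Rightarrow> ('a, 'i) vec \<Rightarrow> ('a, 'i) vec) \<Rightarrow> (('a, 'i) vec \<Rightarrow> 'a \<Rightarrow> 'a) \<Rightarrow>
     (('a, 'i) ext \<Rightarrow> ('a, 'i) ext) \<Rightarrow> bool"
  where "lie_rinehart_bialgebra scaleA bracket anchor \<sigma> \<longleftrightarrow>
    (let sch = schouten scaleA bracket anchor in
      lie_rinehart_algebra scaleA (*s) bracket anchor \<and>
      Vector_Spaces.linear (\<lambda>c. (*s) (scaleA c 1)) (\<lambda>c. (*s) (scaleA c 1)) \<sigma> \<and>
      (\<forall>k. \<forall>x\<in>ext_grade k. \<sigma> x \<in> ext_grade (k + 1)) \<and>
      (\<forall>k. \<forall>x\<in>ext_grade k. \<forall>y. \<sigma> (x \<^bold>\<and> y) = \<sigma> x \<^bold>\<and> y + (- 1) ^ k *s (x \<^bold>\<and> \<sigma> y)) \<and>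
      (\<forall>x. \<sigma> (\<sigma> x) = 0) \<and>
      (\<forall>k. \<forall>x\<in>ext_grade k. \<forall>y. \<sigma> (sch x y) = sch (\<sigma> x) y + (- 1) ^ (k + 1) *s sch x (\<sigma> y)))"


section \<open>Actions on the line and the crossed product\<close>

text \<open>A vector field \<open>f d/dt\<close> is identified with the polynomial \<open>f\<close>.\<close>

definition lie_action ::
    "('k::field \<Rightarrow> 'g::ab_group_add \<Rightarrow> 'g) \<Rightarrow> ('g \<Rightarrow> 'g \<Rightarrow> 'g) \<Rightarrow> ('g \<Rightarrow> 'k poly) \<Rightarrow> bool"
  where "lie_action scl bracket \<theta> \<longleftrightarrow>
    Vector_Spaces.linear scl smult \<theta> \<and>
    (\<forall>X Y. \<theta> (bracket X Y) = \<theta> X * pderiv (\<theta> Y) - pderiv (\<theta> X) * \<theta> Y)"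

definition type3_action ::
    "('k::field \<Rightarrow> 'g::ab_group_add \<Rightarrow> 'g) \<Rightarrow> ('g \<Rightarrow> 'g \<Rightarrow> 'g) \<Rightarrow> ('g \<Rightarrow> 'k poly) \<Rightarrow> bool"
  where "type3_action scl bracket \<theta> \<longleftrightarrow>
    lie_action scl bracket \<theta> \<and> vector_space.dim smult (range \<theta>) = 3"

definition ordered_basis ::
    "('k::field \<Rightarrow> 'g::ab_group_add \<Rightarrow> 'g) \<Rightarrow> ('i::{finite,linorder} \<Rightarrow> 'g) \<Rightarrow> bool"
  where "ordered_basis scl e \<longleftrightarrow>
    inj e \<and> \<not> module.dependent scl (range e) \<and> module.span scl (range e) = UNIV"

text \<open>With respect to an ordered basis \<open>e\<close> of the Lie algebra \<open>\<gg>\<close>, the \<open>K[t]\<close>-module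
  \<open>K[t] \<otimes> \<gg>\<close> is \<open>K[t] ^ I\<close>, and \<open>tensor scl e f X\<close> is \<open>f \<otimes> X\<close>.\<close>

definition tensor ::
    "('k::field \<Rightarrow> 'g::ab_group_add \<Rightarrow> 'g) \<Rightarrow> ('i::{finite,linorder} \<Rightarrow> 'g) \<Rightarrow>
     'k poly \<Rightarrow> 'g \<Rightarrow> ('k poly, 'i) vec"
  where "tensor scl e f X = (\<chi> i. smult (module.representation scl (range e) X (e i)) f)"

definition anchor_poly ::
    "('i::{finite,linorder} \<Rightarrow> 'g) \<Rightarrow> ('g \<Rightarrow> 'k::field poly) \<Rightarrow> ('k poly, 'i) vec \<Rightarrow> 'k poly"
  where "anchor_poly e \<theta> u = (\<Sum>i\<in>UNIV. u $ i * \<theta> (e i))"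

definition crossed_anchor ::
    "('i::{finite,linorder} \<Rightarrow> 'g) \<Rightarrow> ('g \<Rightarrow> 'k::field poly) \<Rightarrow> ('k poly, 'i) vec \<Rightarrow> 'k poly \<Rightarrow> 'k poly"
  where "crossed_anchor e \<theta> u f = anchor_poly e \<theta> u * pderiv f"

text \<open>The biadditive extension of
  \<open>[a X, b Y] = a b [X, Y] + a (\<theta>(X) b) Y - b (\<theta>(Y) a) X\<close> from basis vectors \<open>X\<close> and \<open>Y\<close>; by
  \<open>crossed_bracket_tensor\<close> below the formula then holds for all \<open>X\<close> and \<open>Y\<close>.\<close>

definition crossed_bracket ::
    "('k::field \<Rightarrow> 'g::ab_group_add \<Rightarrow> 'g) \<Rightarrow> ('g \<Rightarrow> 'g \<Rightarrow> 'g) \<Rightarrow> ('i::{finite,linorder} \<Rightarrow> 'g) \<Rightarrow>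
     ('g \<Rightarrow> 'k poly) \<Rightarrow> ('k poly, 'i) vec \<Rightarrow> ('k poly, 'i) vec \<Rightarrow> ('k poly, 'i) vec"
  where "crossed_bracket scl bracket e \<theta> u v =
    (\<Sum>i\<in>UNIV. \<Sum>j\<in>UNIV.
      tensor scl e (u $ i * v $ j) (bracket (e i) (e j))
      + tensor scl e (u $ i * (\<theta> (e i) * pderiv (v $ j))) (e j)
      - tensor scl e (v $ j * (\<theta> (e j) * pderiv (u $ i))) (e i))"

lemma ordered_basis_expansion:
  assumes "vector_space scl" and "ordered_basis scl e"
  shows "(\<Sum>i\<in>UNIV. scl (module.representation scl (range e) X (e i)) (e i)) = X"
proof -
  interpret vector_space scl by fact
  have e: "inj e" "independent (range e)" "span (range e) = UNIV"
    using assms(2) by (auto simp: ordered_basis_def)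
  have "X = (\<Sum>b\<in>range e. scl (representation (range e) X b) b)"
    using e sum_representation_eq[of "range e" X "range e"] by simp
  also have "\<dots> = (\<Sum>i\<in>UNIV. scl (representation (range e) X (e i)) (e i))"
    using e(1) by (simp add: sum.reindex)
  finally show ?thesis by simp
qed

lemma tensor_add_right:
  assumes "vector_space scl" and "ordered_basis scl e"
  shows "tensor scl e f (X + Y) = tensor scl e f X + tensor scl e f Y"
proof -
  interpret vector_space scl by fact
  show ?thesis
    using assms(2) unfolding ordered_basis_def tensor_def
    by (simp add: vec_eq_iff representation_add smult_add_left)
qed

lemma tensor_scale_right:
  assumes "vector_space scl" and "ordered_basis scl e"
  shows "tensor scl e f (scl c X) = tensor scl e (smult c f) X"
proof -
  interpret vector_space scl by fact
  show ?thesis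
    using assms(2) unfolding ordered_basis_def tensor_def
    by (simp add: vec_eq_iff representation_scale mult.commute)
qed

lemma tensor_sum_right:
  assumes "vector_space scl" and "ordered_basis scl e"
  shows "tensor scl e f (\<Sum>i\<in>I. X i) = (\<Sum>i\<in>I. tensor scl e f (X i))"
proof (induction I rule: infinite_finite_induct)
  case empty
  show ?case using tensor_add_right[OF assms, of f 0 0] by simp
qed (use tensor_add_right[OF assms, of f 0 0] in \<open>simp_all add: tensor_add_right[OF assms]\<close>)

lemma tensor_add_left: "tensor scl e (f + g) X = tensor scl e f X + tensor scl e g X"
  by (simp add: tensor_def vec_eq_iff smult_add_right)

lemma tensor_sum_left:
  "tensor scl e (\<Sum>i\<in>I. f i) X = (\<Sum>i\<in>I. tensor scl e (f i) X)"
proof (induction I rule: infinite_finite_induct)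
qed (simp_all add: tensor_add_left, simp_all add: tensor_def vec_eq_iff)

lemma smult_sum_right: "smult c (\<Sum>i\<in>I. f i) = (\<Sum>i\<in>I. smult c (f i))"
  by (induction I rule: infinite_finite_induct) (simp_all add: smult_add_right)

lemma crossed_bracket_tensor:
  fixes scl :: "'k::field \<Rightarrow> 'g::ab_group_add \<Rightarrow> 'g" and e :: "'i::{finite,linorder} \<Rightarrow> 'g"
  assumes "lie_algebra scl bracket" and "ordered_basis scl e" and "lie_action scl bracket \<theta>"
  shows "crossed_bracket scl bracket e \<theta> (tensor scl e a X) (tensor scl e b Y) =
    tensor scl e (a * b) (bracket X Y) + tensor scl e (a * (\<theta> X * pderiv b)) Y
    - tensor scl e (b * (\<theta> Y * pderiv a)) X"
proof -
  interpret lie_algebra scl bracket by fact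
  note vs = vector_space_axioms
  interpret \<theta>: Vector_Spaces.linear scl smult \<theta> using assms(3) by (simp add: lie_action_def)
  define x where "x i = representation (range e) X (e i)" for i
  define y where "y i = representation (range e) Y (e i)" for i
  have X: "X = (\<Sum>i\<in>UNIV. scl (x i) (e i))" and Y: "Y = (\<Sum>i\<in>UNIV. scl (y i) (e i))"
    unfolding x_def y_def by (rule ordered_basis_expansion[OF vs assms(2), symmetric])+
  have tX: "tensor scl e a X $ i = smult (x i) a"
    and tY: "tensor scl e b Y $ i = smult (y i) b" for a b i
    by (simp_all add: tensor_def x_def y_def)
  have thX: "\<theta> X = (\<Sum>i\<in>UNIV. smult (x i) (\<theta> (e i)))"
    and thY: "\<theta> Y = (\<Sum>i\<in>UNIV. smult (y i) (\<theta> (e i)))"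
    by (subst X Y, simp add: \<theta>.sum \<theta>.scale)+
  have bracket_sum_left: "bracket (\<Sum>i\<in>I. Z i) W = (\<Sum>i\<in>I. bracket (Z i) W)"
    and bracket_sum_right: "bracket W (\<Sum>i\<in>I. Z i) = (\<Sum>i\<in>I. bracket W (Z i))"
    for Z :: "'i \<Rightarrow> 'g" and W I
  proof -
    have "bracket 0 W = 0" "bracket W 0 = 0"
      using bracket_scale_left[of 0 0 W] bracket_scale_right[of W 0 0] by simp_all
    then show "bracket (\<Sum>i\<in>I. Z i) W = (\<Sum>i\<in>I. bracket (Z i) W)"
      and "bracket W (\<Sum>i\<in>I. Z i) = (\<Sum>i\<in>I. bracket W (Z i))"
      by (induction I rule: infinite_finite_induct)
         (simp_all add: bracket_add_left bracket_add_right)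
  qed
  have 1: "tensor scl e (a * b) (bracket X Y) =
    (\<Sum>i\<in>UNIV. \<Sum>j\<in>UNIV. tensor scl e (smult (x i) a * smult (y j) b) (bracket (e i) (e j)))"
    by (subst X, subst Y, subst sum.swap)
       (simp add: bracket_sum_left bracket_sum_right bracket_scale_left bracket_scale_right
         tensor_sum_right[OF vs assms(2)] tensor_scale_right[OF vs assms(2)] mult.commute)
  have 2: "tensor scl e (a * (\<theta> X * pderiv b)) Y =
    (\<Sum>i\<in>UNIV. \<Sum>j\<in>UNIV. tensor scl e (smult (x i) a * (\<theta> (e i) * pderiv (smult (y j) b))) (e j))"
    by (subst Y, unfold thX)
       (simp add: tensor_sum_right[OF vs assms(2)] tensor_scale_right[OF vs assms(2)]
         tensor_sum_left sum_distrib_left sum_distrib_right smult_sum_right pderiv_smult mult.commute)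
  have 3: "tensor scl e (b * (\<theta> Y * pderiv a)) X =
    (\<Sum>i\<in>UNIV. \<Sum>j\<in>UNIV. tensor scl e (smult (y j) b * (\<theta> (e j) * pderiv (smult (x i) a))) (e i))"
    by (subst X, unfold thY, subst sum.swap)
       (simp add: tensor_sum_right[OF vs assms(2)] tensor_scale_right[OF vs assms(2)]
         tensor_sum_left sum_distrib_left sum_distrib_right smult_sum_right pderiv_smult mult.commute)
  show ?thesis
    unfolding crossed_bracket_def tX tY 1 2 3 by (simp add: sum.distrib sum_subtractf)
qed

definition crossed_schouten ::
    "('k::field \<Rightarrow> 'g::ab_group_add \<Rightarrow> 'g) \<Rightarrow> ('g \<Rightarrow> 'g \<Rightarrow> 'g) \<Rightarrow> ('i::{finite,linorder} \<Rightarrow> 'g) \<Rightarrow>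
     ('g \<Rightarrow> 'k poly) \<Rightarrow> ('k poly, 'i) ext \<Rightarrow> ('k poly, 'i) ext \<Rightarrow> ('k poly, 'i) ext"
  where "crossed_schouten scl bracket e \<theta> =
    schouten smult (crossed_bracket scl bracket e \<theta>) (crossed_anchor e \<theta>)"

definition crossed_bialgebra ::
    "('k::field \<Rightarrow> 'g::ab_group_add \<Rightarrow> 'g) \<Rightarrow> ('g \<Rightarrow> 'g \<Rightarrow> 'g) \<Rightarrow> ('i::{finite,linorder} \<Rightarrow> 'g) \<Rightarrow>
     ('g \<Rightarrow> 'k poly) \<Rightarrow> (('k poly, 'i) ext \<Rightarrow> ('k poly, 'i) ext) \<Rightarrow> bool"
  where "crossed_bialgebra scl bracket e \<theta> =
    lie_rinehart_bialgebra smult (crossed_bracket scl bracket e \<theta>) (crossed_anchor e \<theta>)"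


section \<open>Compatible pairs\<close>

definition anchor_kernel ::
    "('i::{finite,linorder} \<Rightarrow> 'g) \<Rightarrow> ('g \<Rightarrow> 'k::field poly) \<Rightarrow> ('k poly, 'i) vec set"
  where "anchor_kernel e \<theta> = {u. anchor_poly e \<theta> u = 0}"

definition kernel_wedge ::
    "('i::{finite,linorder} \<Rightarrow> 'g) \<Rightarrow> ('g \<Rightarrow> 'k::field poly) \<Rightarrow> ('k poly, 'i) ext set"
  where "kernel_wedge e \<theta> =
    module.span (*s) {ext1 u \<^bold>\<and> ext1 v | u v. u \<in> anchor_kernel e \<theta> \<and> v \<in> anchor_kernel e \<theta>}"

definition ext_g ::
    "('k::field \<Rightarrow> 'g::ab_group_add \<Rightarrow> 'g) \<Rightarrow> ('i::{finite,linorder} \<Rightarrow> 'g) \<Rightarrow> 'g \<Rightarrow> ('k poly, 'i) ext"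
  where "ext_g scl e X = ext1 (tensor scl e 1 X)"

definition cocycle ::
    "('k::field \<Rightarrow> 'g::ab_group_add \<Rightarrow> 'g) \<Rightarrow> ('g \<Rightarrow> 'g \<Rightarrow> 'g) \<Rightarrow> ('i::{finite,linorder} \<Rightarrow> 'g) \<Rightarrow>
     ('g \<Rightarrow> 'k poly) \<Rightarrow> ('g \<Rightarrow> ('k poly, 'i) ext) \<Rightarrow> bool"
  where "cocycle scl bracket e \<theta> \<Omega> \<longleftrightarrow>
    (\<forall>X Y. \<Omega> (bracket X Y) =
      crossed_schouten scl bracket e \<theta> (\<Omega> X) (ext_g scl e Y)
      + crossed_schouten scl bracket e \<theta> (ext_g scl e X) (\<Omega> Y))"

text \<open>The \<open>K[t]\<close>-linear map with
  \<open>e\<^bsub>i\<^sub>1\<^esub> \<and> \<dots> \<and> e\<^bsub>i\<^sub>k\<^esub> \<mapsto> \<Sum>\<^sub>m (- 1)\<^sup>m\<^sup>+\<^sup>1 e\<^bsub>i\<^sub>1\<^esub> \<and> \<dots> \<and> \<Omega>(e\<^bsub>i\<^sub>m\<^esub>) \<and> \<dots> \<and> e\<^bsub>i\<^sub>k\<^esub>\<close>;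
  the exponent in the definition is \<open>m - 1\<close>.\<close>

definition extend ::
    "('i::{finite,linorder} \<Rightarrow> 'g) \<Rightarrow> ('g \<Rightarrow> ('k::field poly, 'i) ext) \<Rightarrow>
     ('k poly, 'i) ext \<Rightarrow> ('k poly, 'i) ext"
  where "extend e \<Omega> x =
    (\<Sum>S\<in>UNIV. x $ S *s
      (\<Sum>i\<in>S. (- 1) ^ card {j \<in> S. j < i} *s
        (axis {j \<in> S. j < i} 1 \<^bold>\<and> \<Omega> (e i) \<^bold>\<and> axis {j \<in> S. i < j} 1)))"

definition compatible_pairs ::
    "('k::field \<Rightarrow> 'g::ab_group_add \<Rightarrow> 'g) \<Rightarrow> ('g \<Rightarrow> 'g \<Rightarrow> 'g) \<Rightarrow> ('i::{finite,linorder} \<Rightarrow> 'g) \<Rightarrow>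
     ('g \<Rightarrow> 'k poly) \<Rightarrow> (('k poly, 'i) ext \<times> ('g \<Rightarrow> ('k poly, 'i) ext)) set"
  where "compatible_pairs scl bracket e \<theta> =
    {(\<Lambda>, \<Omega>).
      \<Lambda> \<in> ext_grade 2 \<and>
      Vector_Spaces.linear scl (\<lambda>c. (*s) [:c:]) \<Omega> \<and>
      range \<Omega> \<subseteq> kernel_wedge e \<theta> \<and>
      cocycle scl bracket e \<theta> \<Omega> \<and>
      (\<forall>u. crossed_schouten scl bracket e \<theta>
             ([:1 / 2:] *s crossed_schouten scl bracket e \<theta> \<Lambda> \<Lambda> + extend e \<Omega> \<Lambda>) (ext1 u)
           + extend e \<Omega> (extend e \<Omega> (ext1 u)) = 0)}"

definition pair_equiv ::
    "('k::field \<Rightarrow> 'g::ab_group_add \<Rightarrow> 'g) \<Rightarrow> ('g \<Rightarrow> 'g \<Rightarrow> 'g) \<Rightarrow> ('i::{finite,linorder} \<Rightarrow> 'g) \<Rightarrow>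
     ('g \<Rightarrow> 'k poly) \<Rightarrow> (('k poly, 'i) ext \<times> ('g \<Rightarrow> ('k poly, 'i) ext)) rel"
  where "pair_equiv scl bracket e \<theta> =
    {((\<Lambda>, \<Omega>), (\<Lambda>', \<Omega>')).
      (\<Lambda>, \<Omega>) \<in> compatible_pairs scl bracket e \<theta> \<and>
      (\<Lambda>', \<Omega>') \<in> compatible_pairs scl bracket e \<theta> \<and>
      (\<exists>\<nu>\<in>kernel_wedge e \<theta>. \<Lambda>' = \<Lambda> + \<nu> \<and>
        (\<forall>X. \<Omega>' X = \<Omega> X - crossed_schouten scl bracket e \<theta> \<nu> (ext_g scl e X)))}"

end

(*
  Let X in K[t] (x) g have anchor 1. A differential d of degree 1 is determined by d t and by its
  values on g. Compatibility with [t, t] = 0 puts d t into L, and subtracting [Lambda, _] for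
  Lambda = (d t) /\ X produces a derivation that kills K[t]. Being a derivation of the Schouten
  bracket as well, it maps g to bivectors whose contraction with the anchor is 0, and these form
  L /\ L. Two pairs give the same d iff the difference of the bivectors kills t, that is, lies in
  L /\ L. The square of [Lambda, _] + Omega is [P, _] + Omega^2, where
  P = [Lambda, Lambda] / 2 + Omega(Lambda); if it vanishes on E, it vanishes on f in K[t], since
  (d^2 f) /\ u = 0 for all u in E and E has rank at least 3. That the image of g has dimension 3
  enters only through this rank and through 1 being in the image.
*)
theory Submission
  imports Defs
begin

subsection \<open>The Grassmann algebra\<close>

text \<open>\<open>schouten\<close> is a definite description, so nothing can be computed with it
  until a bracket has been exhibited and shown unique. The one exhibited is a formula in the basis
  that makes sense for inhomogeneous arguments as well. The Jacobi identity, uniqueness and the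
  compatibility of a differential with the bracket are then settled on functions and basis vectors
  alone: the failure of each is a graded derivation in one argument, graded symmetry carries it over
  to the other argument, and a derivation that kills all generators is zero. Derivations are graded
  by parity only, so that operators of degree -1, such as contractions and brackets with functions,
  fit into the same scheme as differentials.\<close>

lemma axis_nth: "axis i a $ j = (if j = i then a else 0)"
  by (simp add: axis_def)

lemma wedge_nth: "(x \<^bold>\<and> y) $ S = (\<Sum>T\<in>Pow S. shuffle_sign T (S - T) * x $ T * y $ (S - T))"
  by (simp add: wedge_def)

lemma wedge_add_left: "(x + y) \<^bold>\<and> z = x \<^bold>\<and> z + y \<^bold>\<and> z"
  and wedge_add_right: "x \<^bold>\<and> (y + z) = x \<^bold>\<and> y + x \<^bold>\<and> z"
  and wedge_scale_left: "(a *s x) \<^bold>\<and> y = a *s (x \<^bold>\<and> y)"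
  and wedge_scale_right: "x \<^bold>\<and> (a *s y) = a *s (x \<^bold>\<and> y)"
  by (simp_all add: vec_eq_iff wedge_nth sum.distrib sum_distrib_left algebra_simps)

lemma wedge_zero_left [simp]: "0 \<^bold>\<and> x = 0"
  and wedge_zero_right [simp]: "x \<^bold>\<and> 0 = 0"
  by (simp_all add: vec_eq_iff wedge_nth)

lemma wedge_minus_left: "(- x) \<^bold>\<and> y = - (x \<^bold>\<and> y)"
  and wedge_minus_right: "x \<^bold>\<and> (- y) = - (x \<^bold>\<and> y)"
  by (simp_all add: vec_eq_iff wedge_nth sum_negf)

lemma wedge_diff_left: "(x - y) \<^bold>\<and> z = x \<^bold>\<and> z - y \<^bold>\<and> z"
  and wedge_diff_right: "x \<^bold>\<and> (y - z) = x \<^bold>\<and> y - x \<^bold>\<and> z"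
  by (simp_all add: vec_eq_iff wedge_nth sum_subtractf algebra_simps)

lemma wedge_sum_left: "sum f I \<^bold>\<and> y = (\<Sum>i\<in>I. f i \<^bold>\<and> y)"
  and wedge_sum_right: "x \<^bold>\<and> sum f I = (\<Sum>i\<in>I. x \<^bold>\<and> f i)"
  by (induction I rule: infinite_finite_induct) (simp_all add: wedge_add_left wedge_add_right)

lemmas wedge_linear =
  wedge_add_left wedge_add_right wedge_scale_left wedge_scale_right wedge_minus_left
  wedge_minus_right wedge_diff_left wedge_diff_right wedge_sum_left wedge_sum_right

lemma vec_scale_simps:
  fixes x y :: "('a::comm_ring_1, 'n::finite) vec"
  shows "a *s (x + y) = a *s x + a *s y" "a *s (x - y) = a *s x - a *s y"
    "(a + c) *s x = a *s x + c *s x" "(a - c) *s x = a *s x - c *s x"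
    "a *s (c *s x) = (a * c) *s x" "a *s (- x) = - (a *s x)" "(- a) *s x = - (a *s x)"
    "a *s sum f I = (\<Sum>i\<in>I. a *s f i)"
  by (simp_all add: vec_eq_iff algebra_simps sum_distrib_left)

lemma vec_scale_one [simp]: "(1 :: 'a::comm_ring_1) *s (x :: ('a, 'n::finite) vec) = x"
  and vec_scale_zero_left [simp]: "(0 :: 'a) *s x = 0"
  and vec_scale_zero_right [simp]: "a *s (0 :: ('a, 'n) vec) = 0"
  by (simp_all add: vec_eq_iff)

section \<open>Shuffle signs and associativity of the wedge product\<close>

lemma shuffle_sign_Un_left:
  fixes S S' T :: "'i::{finite,linorder} set"
  assumes "S \<inter> S' = {}"
  shows "shuffle_sign (S \<union> S') T = shuffle_sign S T * shuffle_sign S' T"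
proof -
  have "{(i, j). i \<in> S \<union> S' \<and> j \<in> T \<and> j < i} =
      {(i, j). i \<in> S \<and> j \<in> T \<and> j < i} \<union> {(i, j). i \<in> S' \<and> j \<in> T \<and> j < i}"
    by auto
  moreover have "{(i, j). i \<in> S \<and> j \<in> T \<and> j < i} \<inter> {(i, j). i \<in> S' \<and> j \<in> T \<and> j < i} = {}"
    using assms by auto
  ultimately show ?thesis
    by (simp add: shuffle_sign_def card_Un_disjoint power_add)
qed

lemma shuffle_sign_Un_right:
  fixes S T T' :: "'i::{finite,linorder} set"
  assumes "T \<inter> T' = {}"
  shows "shuffle_sign S (T \<union> T') = shuffle_sign S T * shuffle_sign S T'"
proof -
  have "{(i, j). i \<in> S \<and> j \<in> T \<union> T' \<and> j < i} =
      {(i, j). i \<in> S \<and> j \<in> T \<and> j < i} \<union> {(i, j). i \<in> S \<and> j \<in> T' \<and> j < i}"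
    by auto
  moreover have "{(i, j). i \<in> S \<and> j \<in> T \<and> j < i} \<inter> {(i, j). i \<in> S \<and> j \<in> T' \<and> j < i} = {}"
    using assms by auto
  ultimately show ?thesis
    by (simp add: shuffle_sign_def card_Un_disjoint power_add)
qed

lemma shuffle_sign_empty [simp]: "shuffle_sign {} T = 1" "shuffle_sign S {} = 1"
  by (simp_all add: shuffle_sign_def)

lemma shuffle_sign_square [simp]: "shuffle_sign S T * shuffle_sign S T = 1"
  by (simp add: shuffle_sign_def flip: power_mult_distrib)

lemma shuffle_sign_square_left [simp]: "shuffle_sign S T * (shuffle_sign S T * a) = a"
  by (simp flip: mult.assoc)

text \<open>Each pair in \<open>S \<times> T\<close> is an inversion for exactly one of the two
  orders, so the two inversion counts add up to \<open>card S * card T\<close>.\<close>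

lemma shuffle_sign_swap:
  fixes S T :: "'i::{finite,linorder} set"
  assumes "S \<inter> T = {}"
  shows "(shuffle_sign S T :: 'a::comm_ring_1) = (- 1) ^ (card S * card T) * shuffle_sign T S"
proof -
  let ?A = "{(i, j). i \<in> S \<and> j \<in> T \<and> j < i}" and ?B = "{(i, j). i \<in> T \<and> j \<in> S \<and> j < i}"
  have "S \<times> T = ?A \<union> prod.swap ` ?B"
    using assms by (auto simp: image_iff)
  then have "card (S \<times> T) = card (?A \<union> prod.swap ` ?B)" by simp
  also have "\<dots> = card ?A + card (prod.swap ` ?B)"
    by (rule card_Un_disjoint) auto
  also have "card (prod.swap ` ?B) = card ?B"
    by (rule card_image) (rule inj_swap)
  finally have "card S * card T = card ?A + card ?B"
    by simp
  then have "(- 1 :: 'a) ^ (card S * card T) = shuffle_sign S T * shuffle_sign T S"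
    by (simp only: shuffle_sign_def power_add)
  then show ?thesis
    by (simp add: mult.assoc)
qed

lemma wedge_axis:
  "axis S a \<^bold>\<and> axis T c =
    (if S \<inter> T = {} then axis (S \<union> T) (shuffle_sign S T * a * c) else 0)"
proof (rule vec_eq_iff[THEN iffD2], rule allI)
  fix U
  have "(axis S a \<^bold>\<and> axis T c) $ U =
      (\<Sum>V\<in>Pow U. if V = S then shuffle_sign S (U - S) * a * axis T c $ (U - S) else 0)"
    unfolding wedge_nth by (rule sum.cong) (auto simp: axis_def)
  also have "\<dots> = (if S \<subseteq> U \<and> U - S = T then shuffle_sign S T * a * c else 0)"
    by (auto simp: axis_def)
  also have "\<dots> = (if S \<inter> T = {} then axis (S \<union> T) (shuffle_sign S T * a * c) else 0) $ U"
    by (auto simp: axis_def)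
  finally show "(axis S a \<^bold>\<and> axis T c) $ U = \<dots>" .
qed

text \<open>Reduces identities that are additive in each argument to scaled basis vectors. The
  coefficient stays arbitrary because some of the maps to come differentiate coefficients and are
  additive without being linear over the ring.\<close>

lemma vec_induct [case_names axis add]:
  fixes x :: "('a::comm_ring_1, 'n::finite) vec"
  assumes axis: "\<And>i a. P (axis i a)" and add: "\<And>x y. P x \<Longrightarrow> P y \<Longrightarrow> P (x + y)"
  shows "P x"
proof -
  have "P (\<Sum>i\<in>I. axis i (x $ i))" for I
  proof (induction I rule: infinite_finite_induct)
    case empty
    have "axis undefined 0 = (0 :: ('a, 'n) vec)" by (simp add: axis_def vec_eq_iff)
    then show ?case using axis[of undefined 0] by (simp only: sum.empty)
  next
    case (infinite I)
    then show ?case by simp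
  qed (simp add: axis add)
  moreover have "(\<Sum>i\<in>UNIV. axis i (x $ i)) = x"
    by (simp add: vec_eq_iff axis_def)
  ultimately show ?thesis by metis
qed

lemma wedge_assoc: "(x \<^bold>\<and> y) \<^bold>\<and> z = x \<^bold>\<and> (y \<^bold>\<and> z)"
proof (induction x rule: vec_induct)
  case x: (axis S a)
  show ?case
  proof (induction y rule: vec_induct)
    case y: (axis T b)
    show ?case
    proof (induction z rule: vec_induct)
      case z: (axis U c)
      show ?case
        by (auto simp: wedge_axis Int_Un_distrib Int_Un_distrib2 shuffle_sign_Un_left
            shuffle_sign_Un_right Un_assoc mult_ac)
    qed (simp add: wedge_linear)
  qed (simp add: wedge_linear)
qed (simp add: wedge_linear)

text \<open>All signs depend on grades modulo 2 only. With parities, an operator of degree -1 can be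
  given degree \<open>Suc 0\<close>, and no truncated subtraction arises.\<close>

definition ext_parity :: "nat \<Rightarrow> ('a::comm_ring_1, 'i::{finite,linorder}) ext set"
  where "ext_parity k = {x. \<forall>S. x $ S \<noteq> 0 \<longrightarrow> even (card S) = even k}"

lemma ext_parity_cong: "even k = even l \<Longrightarrow> ext_parity k = ext_parity l"
  by (simp add: ext_parity_def)

lemma ext_grade_parity: "x \<in> ext_grade k \<Longrightarrow> x \<in> ext_parity k"
  by (simp add: ext_parity_def ext_grade_def)

lemma ext_grade_2_parity: "x \<in> ext_grade 2 \<Longrightarrow> x \<in> ext_parity 0"
  using ext_grade_parity ext_parity_cong[of 2 0] by fastforce

lemma ext_parity_zero [simp]: "0 \<in> ext_parity k"
  by (simp add: ext_parity_def)

lemma ext_parity_add: "x \<in> ext_parity k \<Longrightarrow> y \<in> ext_parity k \<Longrightarrow> x + y \<in> ext_parity k"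
  unfolding ext_parity_def by simp (metis add.right_neutral)

lemma ext_parity_minus: "x \<in> ext_parity k \<Longrightarrow> - x \<in> ext_parity k"
  unfolding ext_parity_def by simp

lemma ext_parity_diff: "x \<in> ext_parity k \<Longrightarrow> y \<in> ext_parity k \<Longrightarrow> x - y \<in> ext_parity k"
  using ext_parity_add[of x k "- y"] by (simp add: ext_parity_minus)

lemma ext_parity_scale: "x \<in> ext_parity k \<Longrightarrow> a *s x \<in> ext_parity k"
  unfolding ext_parity_def by simp (metis mult_zero_right)

lemma ext_parity_axis: "even (card S) = even k \<Longrightarrow> axis S a \<in> ext_parity k"
  by (simp add: ext_parity_def axis_def)

lemma ext_grade_zero [simp]: "0 \<in> ext_grade k"
  by (simp add: ext_grade_def)

lemma ext_grade_add: "x \<in> ext_grade k \<Longrightarrow> y \<in> ext_grade k \<Longrightarrow> x + y \<in> ext_grade k"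
  unfolding ext_grade_def by simp (metis add.right_neutral)

lemma ext_grade_minus: "x \<in> ext_grade k \<Longrightarrow> - x \<in> ext_grade k"
  unfolding ext_grade_def by simp

lemma ext_grade_diff: "x \<in> ext_grade k \<Longrightarrow> y \<in> ext_grade k \<Longrightarrow> x - y \<in> ext_grade k"
  using ext_grade_add[of x k "- y"] by (simp add: ext_grade_minus)

lemma ext_grade_scale: "x \<in> ext_grade k \<Longrightarrow> a *s x \<in> ext_grade k"
  unfolding ext_grade_def by simp (metis mult_zero_right)

lemma ext_grade_sum: "(\<And>i. i \<in> I \<Longrightarrow> f i \<in> ext_grade k) \<Longrightarrow> sum f I \<in> ext_grade k"
  by (induction I rule: infinite_finite_induct) (simp_all add: ext_grade_add)

lemma ext_grade_axis: "axis S a \<in> ext_grade (card S)"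
  by (simp add: ext_grade_def axis_def)

lemma wedge_nonzero_nth:
  assumes "(x \<^bold>\<and> y) $ S \<noteq> 0"
  obtains T where "T \<subseteq> S" "x $ T \<noteq> 0" "y $ (S - T) \<noteq> 0"
proof -
  obtain T where "T \<in> Pow S" "shuffle_sign T (S - T) * x $ T * y $ (S - T) \<noteq> 0"
    using assms unfolding wedge_nth by (meson sum.not_neutral_contains_not_neutral)
  then show ?thesis by (intro that[of T]) auto
qed

lemma card_Diff_split:
  fixes S :: "'i::finite set"
  shows "T \<subseteq> S \<Longrightarrow> card S = card T + card (S - T)"
  by (metis card_Diff_subset card_mono finite le_add_diff_inverse)

lemma ext_parity_wedge:
  assumes "x \<in> ext_parity k" "y \<in> ext_parity l"
  shows "x \<^bold>\<and> y \<in> ext_parity (k + l)"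
  unfolding ext_parity_def
proof (clarify elim!: wedge_nonzero_nth)
  fix S T
  assume "T \<subseteq> S" "x $ T \<noteq> 0" "y $ (S - T) \<noteq> 0"
  then show "even (card S) = even (k + l)"
    using assms by (simp add: ext_parity_def card_Diff_split)
qed

lemma ext_grade_wedge:
  assumes "x \<in> ext_grade k" "y \<in> ext_grade l"
  shows "x \<^bold>\<and> y \<in> ext_grade (k + l)"
  unfolding ext_grade_def
proof (clarify elim!: wedge_nonzero_nth)
  fix S T
  assume "T \<subseteq> S" "x $ T \<noteq> 0" "y $ (S - T) \<noteq> 0"
  then show "card S = k + l"
    using assms by (simp add: ext_grade_def card_Diff_split)
qed

lemma minus_one_power_cong: "even m = even n \<Longrightarrow> (- 1 :: 'a::ring_1) ^ m = (- 1) ^ n"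
  by (simp add: minus_one_power_iff)

lemma wedge_commute:
  fixes x y :: "('a::comm_ring_1, 'i::{finite,linorder}) ext"
  assumes "x \<in> ext_parity k" "y \<in> ext_parity l"
  shows "x \<^bold>\<and> y = (- 1) ^ (k * l) *s (y \<^bold>\<and> x)"
proof (rule vec_eq_iff[THEN iffD2], rule allI)
  fix S
  have *: "shuffle_sign T (S - T) * x $ T * y $ (S - T) =
      (- 1) ^ (k * l) * (shuffle_sign (S - T) T * y $ (S - T) * x $ T)" for T
  \<comment> \<open>The hypotheses determine the parity of \<open>card T * card (S - T)\<close> only
    where both coefficients are nonzero; elsewhere both sides vanish.\<close>
  proof (cases "x $ T = 0 \<or> y $ (S - T) = 0")
    case False
    then have "(- 1 :: 'a) ^ (card T * card (S - T)) = (- 1) ^ (k * l)"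
      using assms by (intro minus_one_power_cong) (auto simp: ext_parity_def)
    then show ?thesis
      by (subst shuffle_sign_swap) (auto simp: mult_ac)
  qed auto
  have "(x \<^bold>\<and> y) $ S = (\<Sum>T\<in>Pow S. (- 1) ^ (k * l) * (shuffle_sign T (S - T) * y $ T * x $ (S - T)))"
    unfolding wedge_nth * 
    by (rule sum.reindex_bij_witness[of _ "\<lambda>T. S - T" "\<lambda>T. S - T"]) (auto simp: double_diff)
  then show "(x \<^bold>\<and> y) $ S = ((- 1) ^ (k * l) *s (y \<^bold>\<and> x)) $ S"
    by (simp add: wedge_nth sum_distrib_left)
qed

abbreviation gen :: "'i::{finite,linorder} \<Rightarrow> ('a::comm_ring_1, 'i) ext"
  where "gen i \<equiv> axis {i} 1"

lemma gen_parity: "gen i \<in> ext_parity (Suc 0)"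
  by (simp add: ext_parity_axis)

lemma ext0_parity: "ext0 a \<in> ext_parity 0"
  by (simp add: ext0_def ext_parity_axis)

lemma ext0_grade: "ext0 a \<in> ext_grade 0"
  using ext_grade_axis[of "{}" a] by (simp add: ext0_def)

lemma gen_grade: "gen i \<in> ext_grade (Suc 0)"
  using ext_grade_axis[of "{i}"] by simp

lemma wedge_ext0_left [simp]: "ext0 a \<^bold>\<and> x = a *s x"
  by (induction x rule: vec_induct)
    (simp_all add: ext0_def wedge_axis wedge_linear vec_scale_simps, simp add: axis_def vec_eq_iff)

lemma wedge_ext0_right [simp]: "x \<^bold>\<and> ext0 a = a *s x"
  by (induction x rule: vec_induct)
    (simp_all add: ext0_def wedge_axis wedge_linear vec_scale_simps mult.commute,
     simp add: axis_def vec_eq_iff)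

lemma ext1_alt: "ext1 u = (\<Sum>i\<in>UNIV. u $ i *s gen i)"
  unfolding ext1_def by (rule sum.cong) (simp_all add: axis_def vec_eq_iff)

lemma ext1_nth [simp]: "ext1 u $ {i} = u $ i"
  by (simp add: ext1_def axis_def)

lemma ext1_grade: "ext1 u \<in> ext_grade (Suc 0)"
  unfolding ext1_alt by (intro ext_grade_sum ext_grade_scale gen_grade)

lemma ext_grade_0_ext0:
  assumes "x \<in> ext_grade 0" shows "x = ext0 (x $ {})"
proof (rule vec_eq_iff[THEN iffD2], rule allI)
  fix S show "x $ S = ext0 (x $ {}) $ S"
    using assms by (cases "S = {}") (auto simp: ext0_def axis_def ext_grade_def)
qed

lemma ext_grade_1_ext1:
  assumes "x \<in> ext_grade (Suc 0)" shows "x = ext1 (\<chi> i. x $ {i})"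
proof (rule vec_eq_iff[THEN iffD2], rule allI)
  fix S show "x $ S = ext1 (\<chi> i. x $ {i}) $ S"
  proof (cases "card S = 1")
    case True
    then obtain i where "S = {i}" by (rule card_1_singletonE)
    then show ?thesis by simp
  next
    case False
    then have "y $ S = 0" if "y \<in> ext_grade (Suc 0)" for y :: "('a, 'b) ext"
      using that by (auto simp: ext_grade_def)
    then show ?thesis using assms ext1_grade by metis
  qed
qed

lemma ext0_scale: "a *s ext0 c = ext0 (a * c)"
  by (simp add: ext0_def axis_def vec_eq_iff)

lemma ext0_0 [simp]: "ext0 0 = 0"
  by (simp add: ext0_def axis_def vec_eq_iff)

lemma ext0_add: "ext0 (a + c) = ext0 a + ext0 c"
  and ext0_diff: "ext0 (a - c) = ext0 a - ext0 c"
  and ext0_minus: "ext0 (- a) = - ext0 a"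
  by (simp_all add: ext0_def axis_def vec_eq_iff)

lemma ext0_sum: "ext0 (sum f I) = (\<Sum>i\<in>I. ext0 (f i))"
  by (induction I rule: infinite_finite_induct) (simp_all add: ext0_add)

lemma ext0_eq_iff [simp]:
  "ext0 a = (ext0 c :: ('a::comm_ring_1, 'i::{finite,linorder}) ext) \<longleftrightarrow> a = c"
  by (metis axis_nth ext0_def)

lemma ext1_parity: "ext1 u \<in> ext_parity (Suc 0)"
  using ext1_grade ext_grade_parity by blast

lemma ext1_linear:
  "ext1 (u + v) = ext1 u + ext1 v" "ext1 (a *s u) = a *s ext1 u" "ext1 0 = 0"
  "ext1 (u - v) = ext1 u - ext1 v" "ext1 (- u) = - ext1 u"
  by (simp_all add: ext1_alt vec_scale_simps sum.distrib sum_subtractf sum_negf)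

lemma ext1_sum: "ext1 (sum F I) = (\<Sum>i\<in>I. ext1 (F i))"
  by (induction I rule: infinite_finite_induct) (simp_all add: ext1_linear)

lemma ext1_eq_iff [simp]: "ext1 u = ext1 v \<longleftrightarrow> u = v"
  by (metis ext1_nth vec_eq_iff)

lemma gen_eq_ext1: "gen i = ext1 (axis i 1)"
  using ext_grade_1_ext1[OF gen_grade, of i] by (simp add: axis_def)

section \<open>Interior products with the dual basis\<close>

lemma wedge_gen_nth:
  "(gen i \<^bold>\<and> x) $ S = (if i \<in> S then shuffle_sign {i} (S - {i}) * x $ (S - {i}) else 0)"
proof (induction x rule: vec_induct)
  case (axis T a)
  have "insert i T = S \<longleftrightarrow> T = S - {i} \<and> i \<in> S" if "i \<notin> T" using that by auto
  then show ?case by (auto simp: wedge_axis axis_nth)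
qed (simp_all add: wedge_linear distrib_left)

text \<open>The interior product with the dual basis vector of index \<open>i\<close>; the sign
  comes from moving \<open>i\<close> to the front of \<open>insert i S\<close>.\<close>

definition contract :: "'i::{finite,linorder} \<Rightarrow> ('a::comm_ring_1, 'i) ext \<Rightarrow> ('a, 'i) ext"
  where "contract i x = (\<chi> S. if i \<in> S then 0 else shuffle_sign {i} S * x $ insert i S)"

lemma contract_nth:
  "contract i x $ S = (if i \<in> S then 0 else shuffle_sign {i} S * x $ insert i S)"
  by (simp add: contract_def)

lemma contract_add: "contract i (x + y) = contract i x + contract i y"
  and contract_scale: "contract i (a *s x) = a *s contract i x"
  and contract_zero [simp]: "contract i 0 = 0"
  by (auto simp: vec_eq_iff contract_nth algebra_simps)

lemma contract_sum: "contract i (sum f I) = (\<Sum>j\<in>I. contract i (f j))"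
  by (induction I rule: infinite_finite_induct) (simp_all add: contract_add)

lemma contract_ext0 [simp]: "contract i (ext0 a) = 0"
  by (auto simp: vec_eq_iff contract_nth ext0_def axis_def)

lemma contract_gen [simp]: "contract i (gen j) = (if i = j then ext0 1 else 0)"
  by (auto simp: vec_eq_iff contract_nth ext0_def axis_def)

lemma contract_ext1 [simp]: "contract i (ext1 u) = ext0 (u $ i)"
proof -
  have "u $ i *s ext0 1 = ext0 (u $ i)" by (simp add: ext0_def axis_def vec_eq_iff)
  then show ?thesis
    by (simp add: ext1_alt contract_sum contract_scale if_distrib[of "\<lambda>x. _ *s x"] cong: if_cong)
qed

lemma contract_parity:
  assumes "x \<in> ext_parity k" shows "contract i x \<in> ext_parity (k + 1)"
  unfolding ext_parity_def
proof clarify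
  fix S assume "contract i x $ S \<noteq> 0"
  then have "i \<notin> S" "x $ insert i S \<noteq> 0" by (auto simp: contract_nth split: if_splits)
  then have "even (card (insert i S)) = even k" "card (insert i S) = card S + 1"
    using assms by (auto simp: ext_parity_def)
  then show "even (card S) = even (k + 1)" by auto
qed

lemma contract_grade:
  assumes "x \<in> ext_grade (Suc k)" shows "contract i x \<in> ext_grade k"
  unfolding ext_grade_def
proof clarify
  fix S assume "contract i x $ S \<noteq> 0"
  then have "i \<notin> S" "x $ insert i S \<noteq> 0" by (auto simp: contract_nth split: if_splits)
  then have "card (insert i S) = Suc k" "card (insert i S) = card S + 1"
    using assms by (auto simp: ext_grade_def)
  then show "card S = k" by simp
qed

lemma contract_grade_0: "x \<in> ext_grade 0 \<Longrightarrow> contract i x = 0"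
  using ext_grade_0_ext0 contract_ext0 by metis

text \<open>Both factors are split as \<open>x0 + gen i \<and> x1\<close>, where \<open>i\<close>
  occurs in neither \<open>x0\<close> nor \<open>x1\<close>. On such a sum \<open>contract i\<close>
  just strips \<open>gen i\<close>, so all that remains is the sign of moving \<open>gen i\<close>
  past \<open>x0\<close> and past \<open>x1\<close>.\<close>

lemma contract_wedge:
  fixes x y :: "('a::comm_ring_1, 'i::{finite,linorder}) ext"
  assumes "x \<in> ext_parity k"
  shows "contract i (x \<^bold>\<and> y) = contract i x \<^bold>\<and> y + (- 1) ^ k *s (x \<^bold>\<and> contract i y)"
proof -
  define free where "free = {x :: ('a, 'i) ext. \<forall>S. i \<in> S \<longrightarrow> x $ S = 0}"
  have contract_free: "contract i x = 0" if "x \<in> free" for x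
    using that by (auto simp: free_def contract_nth vec_eq_iff)
  have contract_gen_free: "contract i (gen i \<^bold>\<and> x) = x" if "x \<in> free" for x
    using that by (auto simp: free_def contract_nth vec_eq_iff wedge_gen_nth)
  have free_contract: "contract i x \<in> free" for x
    by (auto simp: free_def contract_nth)
  have free_rest: "x - gen i \<^bold>\<and> contract i x \<in> free" for x
    by (auto simp: free_def contract_nth wedge_gen_nth insert_absorb)
  have free_wedge: "x \<^bold>\<and> y \<in> free" if "x \<in> free" "y \<in> free" for x y
    unfolding free_def
  proof (clarify, rule ccontr)
    fix S assume "i \<in> S" "(x \<^bold>\<and> y) $ S \<noteq> 0"
    moreover from this(2) obtain T where "T \<subseteq> S" "x $ T \<noteq> 0" "y $ (S - T) \<noteq> 0"
      by (rule wedge_nonzero_nth)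
    ultimately have "i \<notin> T" "i \<notin> S - T" using that by (auto simp: free_def)
    then show False using \<open>i \<in> S\<close> by simp
  qed
  define x1 where "x1 = contract i x"
  define x0 where "x0 = x - gen i \<^bold>\<and> x1"
  define y1 where "y1 = contract i y"
  define y0 where "y0 = y - gen i \<^bold>\<and> y1"
  have free: "x0 \<in> free" "x1 \<in> free" "y0 \<in> free" "y1 \<in> free"
    by (simp_all add: x0_def x1_def y0_def y1_def free_rest free_contract)
  have x1: "x1 \<in> ext_parity (k + 1)" using assms contract_parity x1_def by blast
  have x0: "x0 \<in> ext_parity k"
    unfolding x0_def using ext_parity_wedge[OF gen_parity x1, of i] assms
    by (intro ext_parity_diff) (simp_all add: ext_parity_def)
  have x: "x = x0 + gen i \<^bold>\<and> x1" and y: "y = y0 + gen i \<^bold>\<and> y1" by (simp_all add: x0_def y0_def)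
  have x0gen: "x0 \<^bold>\<and> (gen i \<^bold>\<and> z) = (- 1) ^ k *s (gen i \<^bold>\<and> (x0 \<^bold>\<and> z))" for z
    using wedge_commute[OF x0 gen_parity[of i]] by (simp add: wedge_linear flip: wedge_assoc)
  have x1gen: "x1 \<^bold>\<and> (gen i \<^bold>\<and> z) = - ((- 1) ^ k *s (gen i \<^bold>\<and> (x1 \<^bold>\<and> z)))" for z
    using wedge_commute[OF x1 gen_parity[of i]]
    by (simp add: wedge_linear vec_scale_simps flip: wedge_assoc)
  have gengen: "gen i \<^bold>\<and> (gen i \<^bold>\<and> z) = 0" for z :: "('a, 'i) ext"
    by (simp add: wedge_axis flip: wedge_assoc)
  have "x \<^bold>\<and> y = x0 \<^bold>\<and> y0 + (- 1) ^ k *s (gen i \<^bold>\<and> (x0 \<^bold>\<and> y1)) + gen i \<^bold>\<and> (x1 \<^bold>\<and> y0)"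
    unfolding x y
    by (simp add: wedge_linear wedge_assoc x0gen x1gen gengen vec_scale_simps)
  then have "contract i (x \<^bold>\<and> y) = (- 1) ^ k *s (x0 \<^bold>\<and> y1) + x1 \<^bold>\<and> y0"
    by (simp add: contract_add contract_scale contract_free contract_gen_free free_wedge free)
  moreover have "x1 \<^bold>\<and> y + (- 1) ^ k *s (x \<^bold>\<and> y1) =
      x1 \<^bold>\<and> y0 + x1 \<^bold>\<and> (gen i \<^bold>\<and> y1) + (- 1) ^ k *s (x0 \<^bold>\<and> y1)
        + (- 1) ^ k *s (gen i \<^bold>\<and> (x1 \<^bold>\<and> y1))"
    unfolding x y by (simp add: wedge_linear wedge_assoc vec_scale_simps)
  ultimately show ?thesis
    by (simp add: x1gen wedge_linear wedge_assoc flip: x1_def y1_def)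
qed

text \<open>An element is the sum of its components over all \<open>S\<close>, including those of
  the wrong parity. These components are 0, which is what the case \<open>zero\<close> is
  for.\<close>

lemma ext_parity_induct [consumes 1, case_names axis zero add]:
  fixes x :: "('a::comm_ring_1, 'i::{finite,linorder}) ext"
  assumes "x \<in> ext_parity k"
    and axis: "\<And>S a. even (card S) = even k \<Longrightarrow> P (axis S a)"
    and zero: "P 0"
    and add: "\<And>x y. x \<in> ext_parity k \<Longrightarrow> y \<in> ext_parity k \<Longrightarrow> P x \<Longrightarrow> P y \<Longrightarrow> P (x + y)"
  shows "P x"
proof -
  have ax: "axis S (x $ S) \<in> ext_parity k \<and> P (axis S (x $ S))" for S
  proof (cases "x $ S = 0")
    case True
    then have "axis S (x $ S) = 0" by simp
    then show ?thesis using zero by (simp only: ext_parity_zero)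
  next
    case False
    then have "even (card S) = even k" using assms(1) by (simp add: ext_parity_def)
    then show ?thesis using axis ext_parity_axis by blast
  qed
  have "(\<Sum>S\<in>I. axis S (x $ S)) \<in> ext_parity k \<and> P (\<Sum>S\<in>I. axis S (x $ S))" for I
    by (induction I rule: infinite_finite_induct) (simp_all add: zero ax add ext_parity_add)
  moreover have "(\<Sum>S\<in>UNIV. axis S (x $ S)) = x"
    by (simp add: vec_eq_iff axis_def)
  ultimately show ?thesis by metis
qed

subsection \<open>Graded derivations\<close>

text \<open>The degree \<open>p\<close> matters modulo 2 only. Additivity takes the place of
  linearity because these derivations may act on coefficients.\<close>

definition ext_derivation ::
    "nat \<Rightarrow> (('a::comm_ring_1, 'i::{finite,linorder}) ext \<Rightarrow> ('a, 'i) ext) \<Rightarrow> bool"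
  where "ext_derivation p D \<longleftrightarrow>
    (\<forall>x y. D (x + y) = D x + D y) \<and>
    (\<forall>k. \<forall>x\<in>ext_parity k. D x \<in> ext_parity (k + p)) \<and>
    (\<forall>k. \<forall>x\<in>ext_parity k. \<forall>y. D (x \<^bold>\<and> y) = D x \<^bold>\<and> y + (- 1) ^ (p * k) *s (x \<^bold>\<and> D y))"

lemma ext_derivationI:
  assumes "\<And>x y. D (x + y) = D x + D y"
    and "\<And>k x. x \<in> ext_parity k \<Longrightarrow> D x \<in> ext_parity (k + p)"
    and "\<And>k x y. x \<in> ext_parity k \<Longrightarrow>
      D (x \<^bold>\<and> y) = D x \<^bold>\<and> y + (- 1) ^ (p * k) *s (x \<^bold>\<and> D y)"
  shows "ext_derivation p D"
  using assms by (simp add: ext_derivation_def)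

lemma additive_0:
  fixes f :: "'a::ab_group_add \<Rightarrow> 'b::ab_group_add"
  assumes "\<And>x y. f (x + y) = f x + f y" shows "f 0 = 0"
  using assms[of 0 0] by simp

lemma additive_minus:
  fixes f :: "'a::ab_group_add \<Rightarrow> 'b::ab_group_add"
  assumes "\<And>x y. f (x + y) = f x + f y" shows "f (- x) = - f x"
  using assms[of x "- x"] additive_0[of f, OF assms] by (simp add: add_eq_0_iff)

text \<open>A bridge from the axioms of brackets and bialgebras, which speak of a fixed grade:
  scaled basis vectors are homogeneous and generate each parity class additively.\<close>

lemma ext_derivation_gradeI:
  fixes D :: "('a::comm_ring_1, 'i::{finite,linorder}) ext \<Rightarrow> ('a, 'i) ext"
  assumes add: "\<And>x y. D (x + y) = D x + D y"
    and par: "\<And>k x. x \<in> ext_grade k \<Longrightarrow> D x \<in> ext_parity (k + p)"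
    and leib: "\<And>k x y. x \<in> ext_grade k \<Longrightarrow>
      D (x \<^bold>\<and> y) = D x \<^bold>\<and> y + (- 1) ^ (p * k) *s (x \<^bold>\<and> D y)"
  shows "ext_derivation p D"
proof (rule ext_derivationI)
  note zero = additive_0[of D, OF add]
  fix k and x :: "('a, 'i) ext" assume x: "x \<in> ext_parity k"
  show "D x \<in> ext_parity (k + p)"
    using x
  proof (induction x rule: ext_parity_induct)
    case (axis S a)
    then have "even (card S + p) = even (k + p)" by simp
    then show ?case using par[OF ext_grade_axis[of S a]] ext_parity_cong by blast
  qed (simp_all add: add zero ext_parity_add)
  fix y
  show "D (x \<^bold>\<and> y) = D x \<^bold>\<and> y + (- 1) ^ (p * k) *s (x \<^bold>\<and> D y)"
    using x
  proof (induction x rule: ext_parity_induct)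
    case (axis S a)
    then have "(- 1 :: 'a) ^ (p * k) = (- 1) ^ (p * card S)" by (simp add: minus_one_power_iff)
    then show ?case using leib[OF ext_grade_axis[of S a], of y] by simp
  qed (simp_all add: add zero wedge_linear vec_scale_simps)
qed (fact add)

context
  fixes p :: nat and D :: "('a::comm_ring_1, 'i::{finite,linorder}) ext \<Rightarrow> ('a, 'i) ext"
  assumes D: "ext_derivation p D"
begin

lemma ext_derivation_add: "D (x + y) = D x + D y"
  using D by (simp add: ext_derivation_def)

lemma ext_derivation_parity: "x \<in> ext_parity k \<Longrightarrow> D x \<in> ext_parity (k + p)"
  using D by (simp add: ext_derivation_def)

lemma ext_derivation_wedge:
  "x \<in> ext_parity k \<Longrightarrow> D (x \<^bold>\<and> y) = D x \<^bold>\<and> y + (- 1) ^ (p * k) *s (x \<^bold>\<and> D y)"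
  using D by (simp add: ext_derivation_def)

lemma ext_derivation_0: "D 0 = 0"
  using ext_derivation_add by (rule additive_0)

lemma ext_derivation_minus: "D (- x) = - D x"
  using ext_derivation_add by (rule additive_minus)

lemma ext_derivation_sign: "D ((- 1) ^ n *s x) = (- 1) ^ n *s D x"
  by (simp add: minus_one_power_iff ext_derivation_minus vec_scale_simps)

lemma ext_derivation_scale: "D (a *s x) = D (ext0 a) \<^bold>\<and> x + a *s D x"
  using ext_derivation_wedge[OF ext0_parity, of a x] by simp

text \<open>Vanishing on functions makes \<open>D\<close> linear over the ring. The basis vector of
  \<open>insert i S\<close> is, up to sign, \<open>gen i\<close> times that of \<open>S\<close>, so
  the Leibniz rule allows induction on \<open>S\<close>.\<close>

lemma ext_derivation_eq_0:
  assumes "\<And>a. D (ext0 a) = 0" "\<And>i. D (gen i) = 0"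
  shows "D x = 0"
proof -
  have scale: "D (a *s x) = a *s D x" for a x
    by (simp add: ext_derivation_scale assms(1))
  have "D (axis S 1) = 0" for S
  proof (induction S rule: finite_induct[OF finite])
    case 1
    show ?case using assms(1)[of 1] by (simp add: ext0_def)
  next
    case (2 i S)
    then have "axis (insert i S) (1 :: 'a) = shuffle_sign {i} S *s (gen i \<^bold>\<and> axis S 1)"
      by (simp add: wedge_axis vec_eq_iff axis_nth)
    then show ?case
      by (simp add: scale ext_derivation_wedge[OF gen_parity] assms(2) 2)
  qed
  moreover have "axis S a = a *s axis S (1 :: 'a)" for S :: "'i set" and a
    by (simp add: axis_def vec_eq_iff)
  ultimately have "D (axis S a) = 0" for S a
    by (metis scale vec_scale_zero_right)
  then show ?thesis
    by (induction x rule: vec_induct) (simp_all add: ext_derivation_add)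
qed

lemma ext_derivation_uminus: "ext_derivation p (\<lambda>x. - D x)"
  by (rule ext_derivationI)
    (simp_all add: ext_derivation_add ext_derivation_parity ext_derivation_wedge ext_parity_minus
      wedge_linear vec_scale_simps)

lemma ext_derivation_wedge_left:
  assumes w: "w \<in> ext_parity k"
  shows "ext_derivation (k + p) (\<lambda>x. w \<^bold>\<and> D x)"
proof (rule ext_derivationI)
  fix l and x y :: "('a, 'i) ext" assume x: "x \<in> ext_parity l"
  show "w \<^bold>\<and> D x \<in> ext_parity (l + (k + p))"
    using ext_parity_wedge[OF w ext_derivation_parity[OF x]] by (simp add: ac_simps)
  have "w \<^bold>\<and> (x \<^bold>\<and> D y) = (- 1) ^ (k * l) *s (x \<^bold>\<and> (w \<^bold>\<and> D y))"
    using wedge_commute[OF w x] by (simp add: wedge_linear flip: wedge_assoc)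
  then show "w \<^bold>\<and> D (x \<^bold>\<and> y) = w \<^bold>\<and> D x \<^bold>\<and> y + (- 1) ^ ((k + p) * l) *s (x \<^bold>\<and> (w \<^bold>\<and> D y))"
    by (simp add: ext_derivation_wedge[OF x] wedge_linear wedge_assoc vec_scale_simps
        algebra_simps power_add)
qed (simp add: ext_derivation_add wedge_linear)

lemma ext_derivation_parity_cong:
  assumes "even q = even p" shows "ext_derivation q D"
proof (rule ext_derivationI)
  fix k and x y :: "('a, 'i) ext" assume x: "x \<in> ext_parity k"
  have "ext_parity (k + q) = (ext_parity (k + p) :: ('a, 'i) ext set)"
    using assms by (intro ext_parity_cong) auto
  then show "D x \<in> ext_parity (k + q)" using ext_derivation_parity[OF x] by simp
  have "(- 1 :: 'a) ^ (q * k) = (- 1) ^ (p * k)"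
    using assms by (intro minus_one_power_cong) auto
  then show "D (x \<^bold>\<and> y) = D x \<^bold>\<and> y + (- 1) ^ (q * k) *s (x \<^bold>\<and> D y)"
    using ext_derivation_wedge[OF x] by simp
qed (rule ext_derivation_add)

end

lemma ext_derivation_zero: "ext_derivation p (\<lambda>x. 0)"
  by (rule ext_derivationI) simp_all

lemma ext_derivation_plus:
  assumes "ext_derivation p D" "ext_derivation p E"
  shows "ext_derivation p (\<lambda>x. D x + E x)"
  by (rule ext_derivationI)
    (simp_all add: ext_derivation_add[OF assms(1)] ext_derivation_add[OF assms(2)]
      ext_derivation_parity[OF assms(1)] ext_derivation_parity[OF assms(2)]
      ext_derivation_wedge[OF assms(1)] ext_derivation_wedge[OF assms(2)] ext_parity_add
      wedge_linear vec_scale_simps)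

lemma ext_derivation_subtract:
  assumes "ext_derivation p D" "ext_derivation p E"
  shows "ext_derivation p (\<lambda>x. D x - E x)"
  using ext_derivation_plus[OF assms(1) ext_derivation_uminus[OF assms(2)]] by simp

lemma ext_derivation_sum:
  "(\<And>i. i \<in> I \<Longrightarrow> ext_derivation p (D i)) \<Longrightarrow> ext_derivation p (\<lambda>x. \<Sum>i\<in>I. D i x)"
  by (induction I rule: infinite_finite_induct)
    (simp_all add: ext_derivation_zero ext_derivation_plus)

lemma ext_derivation_eqI:
  assumes "ext_derivation p D" "ext_derivation p E"
    and "\<And>a. D (ext0 a) = E (ext0 a)" "\<And>i. D (gen i) = E (gen i)"
  shows "D x = E x"
  using ext_derivation_eq_0[OF ext_derivation_subtract[OF assms(1,2)], of x] assms(3,4) by simp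

lemma ext_derivation_commutator:
  fixes D E :: "('a::comm_ring_1, 'i::{finite,linorder}) ext \<Rightarrow> ('a, 'i) ext"
  assumes D: "ext_derivation p D" and E: "ext_derivation q E"
  shows "ext_derivation (p + q) (\<lambda>x. D (E x) - (- 1) ^ (p * q) *s E (D x))"
proof (rule ext_derivationI)
  note DE = ext_derivation_add[OF D] ext_derivation_add[OF E]
    ext_derivation_sign[OF D] ext_derivation_sign[OF E]
  fix k and x y :: "('a, 'i) ext" assume x: "x \<in> ext_parity k"
  note par = ext_derivation_parity[OF D x] ext_derivation_parity[OF E x]
  show "D (E x) - (- 1) ^ (p * q) *s E (D x) \<in> ext_parity (k + (p + q))"
    using ext_derivation_parity[OF D par(2)] ext_derivation_parity[OF E par(1)]
    by (intro ext_parity_diff ext_parity_scale) (simp_all add: ac_simps)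
  show "D (E (x \<^bold>\<and> y)) - (- 1) ^ (p * q) *s E (D (x \<^bold>\<and> y)) =
      (D (E x) - (- 1) ^ (p * q) *s E (D x)) \<^bold>\<and> y
      + (- 1) ^ ((p + q) * k) *s (x \<^bold>\<and> (D (E y) - (- 1) ^ (p * q) *s E (D y)))"
    unfolding ext_derivation_wedge[OF D x] ext_derivation_wedge[OF E x] DE
      ext_derivation_wedge[OF D par(2)] ext_derivation_wedge[OF E par(1)]
      ext_derivation_wedge[OF D x] ext_derivation_wedge[OF E x]
    by (cases "even p"; cases "even q"; cases "even k")
      (simp_all add: minus_one_power_iff wedge_linear vec_scale_simps)
qed (simp add: ext_derivation_add[OF D] ext_derivation_add[OF E] vec_scale_simps)

text \<open>The square is half the graded commutator of \<open>D\<close> with itself, but 2 need not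
  be invertible in the ring. Hence the direct computation, in which the two terms
  \<open>D x \<and> D y\<close> cancel.\<close>

lemma ext_derivation_square:
  fixes D :: "('a::comm_ring_1, 'i::{finite,linorder}) ext \<Rightarrow> ('a, 'i) ext"
  assumes D: "ext_derivation (Suc 0) D"
  shows "ext_derivation 2 (\<lambda>x. D (D x))"
proof (rule ext_derivationI)
  fix k and x y :: "('a, 'i) ext" assume x: "x \<in> ext_parity k"
  note par = ext_derivation_parity[OF D x]
  show "D (D x) \<in> ext_parity (k + 2)"
    using ext_derivation_parity[OF D par] by simp
  show "D (D (x \<^bold>\<and> y)) = D (D x) \<^bold>\<and> y + (- 1) ^ (2 * k) *s (x \<^bold>\<and> D (D y))"
    by (simp add: ext_derivation_wedge[OF D x] ext_derivation_add[OF D] ext_derivation_sign[OF D]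
        ext_derivation_wedge[OF D par] vec_scale_simps)
qed (simp add: ext_derivation_add[OF D])

lemma ext_derivation_contract: "ext_derivation (Suc 0) (contract i)"
  by (rule ext_derivationI) (use contract_parity in \<open>simp_all add: contract_add contract_wedge\<close>)

section \<open>Derivations of the coefficients, and the grade involution\<close>

definition map_ext :: "('a \<Rightarrow> 'a) \<Rightarrow> ('a::comm_ring_1, 'i::{finite,linorder}) ext \<Rightarrow> ('a, 'i) ext"
  where "map_ext f x = (\<chi> S. f (x $ S))"

lemma map_ext_nth [simp]: "map_ext f x $ S = f (x $ S)"
  by (simp add: map_ext_def)

lemma map_ext_derivation:
  fixes f :: "'a::comm_ring_1 \<Rightarrow> 'a"
  assumes add: "\<And>a c. f (a + c) = f a + f c" and mult: "\<And>a c. f (a * c) = f a * c + a * f c"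
  shows "ext_derivation 0 (map_ext f :: ('a, 'i::{finite,linorder}) ext \<Rightarrow> ('a, 'i) ext)"
proof (rule ext_derivationI)
  have zero: "f 0 = 0" using add by (rule additive_0)
  have minus: "f (- a) = - f a" for a using add by (rule additive_minus)
  have sum: "f (sum g I) = (\<Sum>i\<in>I. f (g i))" for g :: "'i set \<Rightarrow> 'a" and I
    by (induction I rule: infinite_finite_induct) (simp_all add: zero add)
  have sign: "f (shuffle_sign S T * a) = shuffle_sign S T * f a" for S T :: "'i set" and a
    by (simp add: shuffle_sign_def minus_one_power_iff minus)
  fix k and x y :: "('a, 'i) ext"
  show "map_ext f (x + y) = map_ext f x + map_ext f y"
    by (simp add: vec_eq_iff add)
  show "map_ext f (x \<^bold>\<and> y) = map_ext f x \<^bold>\<and> y + (- 1) ^ (0 * k) *s (x \<^bold>\<and> map_ext f y)"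
    by (simp add: vec_eq_iff wedge_nth sum mult.assoc sign) (simp add: mult algebra_simps sum.distrib)
  show "map_ext f x \<in> ext_parity (k + 0)" if "x \<in> ext_parity k"
    using that unfolding ext_parity_def by simp (metis zero)
qed

lemma map_ext_grade: "f 0 = 0 \<Longrightarrow> x \<in> ext_grade k \<Longrightarrow> map_ext f x \<in> ext_grade k"
  unfolding ext_grade_def by simp metis

definition grade_involution ::
    "('a::comm_ring_1, 'i::{finite,linorder}) ext \<Rightarrow> ('a, 'i) ext"
  where "grade_involution x = (\<chi> S. (- 1) ^ card S * x $ S)"

lemma grade_involution_parity:
  fixes x :: "('a::comm_ring_1, 'i::{finite,linorder}) ext"
  assumes "x \<in> ext_parity k"
  shows "grade_involution x = (- 1) ^ k *s x"
proof (rule vec_eq_iff[THEN iffD2], rule allI)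
  fix S
  have "(- 1 :: 'a) ^ card S = (- 1) ^ k" if "x $ S \<noteq> 0"
    using assms that by (intro minus_one_power_cong) (simp add: ext_parity_def)
  then show "grade_involution x $ S = ((- 1) ^ k *s x) $ S"
    by (cases "x $ S = 0") (simp_all add: grade_involution_def)
qed

lemma grade_involution_add: "grade_involution (x + y) = grade_involution x + grade_involution y"
  and grade_involution_scale: "grade_involution (a *s x) = a *s grade_involution x"
  by (simp_all add: grade_involution_def vec_eq_iff algebra_simps)

lemma grade_involution_eq_0_iff [simp]: "grade_involution x = 0 \<longleftrightarrow> x = 0"
  by (auto simp: grade_involution_def vec_eq_iff minus_one_power_iff)

lemma grade_involution_0 [simp]: "grade_involution 0 = 0"
  by simp

lemma grade_involution_sum: "grade_involution (sum f I) = (\<Sum>i\<in>I. grade_involution (f i))"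
  by (induction I rule: infinite_finite_induct) (simp_all add: grade_involution_add)

lemma grade_involution_ext0 [simp]: "grade_involution (ext0 a) = ext0 a"
  using grade_involution_parity[OF ext0_parity] by simp

subsection \<open>The Schouten bracket in a frame\<close>

text \<open>A Lie Rinehart structure on a free module with basis \<open>e\<^sub>i\<close> is given by the derivations
  \<open>\<rho> i\<close> (the anchor of \<open>e\<^sub>i\<close>) and the brackets \<open>b i j\<close> of \<open>e\<^sub>i\<close> and \<open>e\<^sub>j\<close>. The bracket
  \<open>[x, \<cdot>]\<close> is the derivation with \<open>f \<mapsto> \<Sum>\<^sub>i \<plusminus> (\<rho> i f) (contract i x)\<close> and \<open>e\<^sub>j \<mapsto> - [e\<^sub>j, x]\<close>,
  where the grade involution supplies the sign for all \<open>x\<close> at once.\<close>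

definition frame_ad :: "('i \<Rightarrow> 'a \<Rightarrow> 'a) \<Rightarrow> ('i \<Rightarrow> 'i \<Rightarrow> ('a, 'i) vec) \<Rightarrow> 'i \<Rightarrow>
    ('a::comm_ring_1, 'i::{finite,linorder}) ext \<Rightarrow> ('a, 'i) ext"
  where "frame_ad \<rho> b i x = map_ext (\<rho> i) x + (\<Sum>j\<in>UNIV. ext1 (b i j) \<^bold>\<and> contract j x)"

definition frame_schouten :: "('i \<Rightarrow> 'a \<Rightarrow> 'a) \<Rightarrow> ('i \<Rightarrow> 'i \<Rightarrow> ('a, 'i) vec) \<Rightarrow>
    ('a::comm_ring_1, 'i::{finite,linorder}) ext \<Rightarrow> ('a, 'i) ext \<Rightarrow> ('a, 'i) ext"
  where "frame_schouten \<rho> b x y = (\<Sum>i\<in>UNIV.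
    grade_involution (contract i x) \<^bold>\<and> map_ext (\<rho> i) y - frame_ad \<rho> b i x \<^bold>\<and> contract i y)"

text \<open>The axioms of a Lie Rinehart algebra restricted to basis vectors. The structure
  coefficients \<open>b i j\<close> are ring elements on which \<open>\<rho>\<close> may act, so the
  Jacobi identity of three basis vectors involves their derivatives; \<open>frame_ad\<close>
  supplies these.\<close>

locale lie_rinehart_frame =
  fixes \<rho> :: "'i::{finite,linorder} \<Rightarrow> 'a::comm_ring_1 \<Rightarrow> 'a" and b :: "'i \<Rightarrow> 'i \<Rightarrow> ('a, 'i) vec"
  assumes rho_add: "\<rho> i (f + g) = \<rho> i f + \<rho> i g"
    and rho_mult: "\<rho> i (f * g) = \<rho> i f * g + f * \<rho> i g"
    and b_skew: "b j i = - b i j"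
    and rho_bracket: "\<rho> i (\<rho> j f) - \<rho> j (\<rho> i f) = (\<Sum>k\<in>UNIV. b i j $ k * \<rho> k f)"
    and b_jacobi: "frame_ad \<rho> b i (ext1 (b j k)) + frame_ad \<rho> b j (ext1 (b k i))
      + frame_ad \<rho> b k (ext1 (b i j)) = 0"
begin

abbreviation ad where "ad \<equiv> frame_ad \<rho> b"
abbreviation sch where "sch \<equiv> frame_schouten \<rho> b"

lemma rho_0: "\<rho> i 0 = 0"
  using rho_add by (rule additive_0)

lemma rho_1: "\<rho> i 1 = 0"
  using rho_mult[of i 1 1] by simp

lemma map_rho_derivation: "ext_derivation 0 (map_ext (\<rho> i))"
  by (rule map_ext_derivation) (simp_all add: rho_add rho_mult)

lemma ad_derivation: "ext_derivation 0 (ad i)"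
proof -
  have "ext_derivation 0 (\<lambda>x. ext1 (b i j) \<^bold>\<and> contract j x)" for j
    using ext_derivation_wedge_left[OF ext_derivation_contract ext1_parity]
    by (rule ext_derivation_parity_cong) simp
  then show ?thesis
    unfolding frame_ad_def
    by (intro ext_derivation_plus map_rho_derivation ext_derivation_sum)
qed

lemma sch_add_left: "sch (x + y) z = sch x z + sch y z"
  unfolding frame_schouten_def
  by (simp add: contract_add grade_involution_add ext_derivation_add[OF ad_derivation] wedge_linear
      sum.distrib sum_subtractf)

lemma sch_add_right: "sch x (y + z) = sch x y + sch x z"
  unfolding frame_schouten_def
  by (simp add: contract_add ext_derivation_add[OF map_rho_derivation] wedge_linear
      sum.distrib sum_subtractf)

text \<open>Bracketing with an element of grade \<open>k\<close> has degree \<open>k - 1\<close>,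
  which has the parity of \<open>Suc k\<close>. Each summand of the formula is a known derivation
  multiplied from the left.\<close>

lemma sch_derivation:
  assumes x: "x \<in> ext_parity k"
  shows "ext_derivation (Suc k) (sch x)"
proof -
  have "ext_derivation (Suc k) (\<lambda>y. grade_involution (contract i x) \<^bold>\<and> map_ext (\<rho> i) y
      - ad i x \<^bold>\<and> contract i y)" for i
  proof (rule ext_derivation_subtract)
    have "grade_involution (contract i x) \<in> ext_parity (Suc k)"
      using contract_parity[OF x, of i] by (simp add: grade_involution_parity ext_parity_scale)
    from ext_derivation_wedge_left[OF map_rho_derivation this]
    show "ext_derivation (Suc k) (\<lambda>y. grade_involution (contract i x) \<^bold>\<and> map_ext (\<rho> i) y)"
      by simp
    have "ad i x \<in> ext_parity k"
      using ext_derivation_parity[OF ad_derivation x] by simp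
    from ext_derivation_wedge_left[OF ext_derivation_contract this]
    show "ext_derivation (Suc k) (\<lambda>y. ad i x \<^bold>\<and> contract i y)"
      by simp
  qed
  then show ?thesis
    unfolding frame_schouten_def[abs_def] by (intro ext_derivation_sum)
qed

lemma sch_parity: "x \<in> ext_parity k \<Longrightarrow> y \<in> ext_parity l \<Longrightarrow> sch x y \<in> ext_parity (k + l + 1)"
  using ext_derivation_parity[OF sch_derivation] by (fastforce simp: ac_simps)

text \<open>The formula has three sums. The two that contain derivatives of coefficients are
  exchanged when \<open>x\<close> and \<open>y\<close> are, and the one with structure coefficients
  is carried to itself by exchanging its indices and applying \<open>b_skew\<close>.\<close>

lemma sch_skew:
  assumes x: "x \<in> ext_parity k" and y: "y \<in> ext_parity l"
  shows "sch x y = - ((- 1) ^ ((k + 1) * (l + 1)) *s sch y x)"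
proof -
  define s :: 'a where "s = (- 1) ^ ((k + 1) * (l + 1))"
  have par: "contract i x \<in> ext_parity (k + 1)" "contract i y \<in> ext_parity (l + 1)"
    "map_ext (\<rho> i) x \<in> ext_parity k" "map_ext (\<rho> i) y \<in> ext_parity l" for i
    using x y contract_parity ext_derivation_parity[OF map_rho_derivation] by fastforce+
  have 1: "grade_involution (contract i x) \<^bold>\<and> map_ext (\<rho> i) y =
      s *s (map_ext (\<rho> i) y \<^bold>\<and> contract i x)" for i
    using wedge_commute[OF par(1,4)]
    by (cases "even k"; cases "even l") (simp_all add: grade_involution_parity[OF par(1)]
        wedge_linear vec_scale_simps s_def minus_one_power_iff)
  have 2: "map_ext (\<rho> i) x \<^bold>\<and> contract i y =
      s *s (grade_involution (contract i y) \<^bold>\<and> map_ext (\<rho> i) x)" for i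
    using wedge_commute[OF par(3,2)]
    by (cases "even k"; cases "even l") (simp_all add: grade_involution_parity[OF par(2)]
        wedge_linear vec_scale_simps s_def minus_one_power_iff)
  have "(\<Sum>i\<in>UNIV. \<Sum>j\<in>UNIV. ext1 (b i j) \<^bold>\<and> contract j x \<^bold>\<and> contract i y) =
      (\<Sum>i\<in>UNIV. \<Sum>j\<in>UNIV. s *s (ext1 (b i j) \<^bold>\<and> contract i y \<^bold>\<and> contract j x))"
    using wedge_commute[OF par(1,2)] by (simp add: wedge_assoc wedge_linear s_def)
  also have "\<dots> = (\<Sum>i\<in>UNIV. \<Sum>j\<in>UNIV. s *s (ext1 (b j i) \<^bold>\<and> contract j y \<^bold>\<and> contract i x))"
    by (rule sum.swap)
  also have "\<dots> = - (\<Sum>i\<in>UNIV. \<Sum>j\<in>UNIV. s *s (ext1 (b i j) \<^bold>\<and> contract j y \<^bold>\<and> contract i x))"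
  proof -
    have skew: "ext1 (b j i) = - ext1 (b i j)" for i j
      by (subst b_skew) (simp add: ext1_alt vec_scale_simps sum_negf)
    show ?thesis
      unfolding sum_negf[symmetric]
      by (intro sum.cong refl, subst skew) (simp add: wedge_linear vec_scale_simps)
  qed
  finally have 3: "(\<Sum>i\<in>UNIV. \<Sum>j\<in>UNIV. ext1 (b i j) \<^bold>\<and> contract j x \<^bold>\<and> contract i y) =
      - (\<Sum>i\<in>UNIV. \<Sum>j\<in>UNIV. s *s (ext1 (b i j) \<^bold>\<and> contract j y \<^bold>\<and> contract i x))" .
  have split: "sch x y = (\<Sum>i\<in>UNIV. grade_involution (contract i x) \<^bold>\<and> map_ext (\<rho> i) y)
      - (\<Sum>i\<in>UNIV. map_ext (\<rho> i) x \<^bold>\<and> contract i y)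
      - (\<Sum>i\<in>UNIV. \<Sum>j\<in>UNIV. ext1 (b i j) \<^bold>\<and> contract j x \<^bold>\<and> contract i y)" for x y
    unfolding frame_schouten_def frame_ad_def
    by (simp add: sum_subtractf sum.distrib wedge_linear diff_diff_eq)
  show ?thesis
    unfolding split 1 2 3 s_def[symmetric] vec_scale_simps by simp
qed

lemma map_rho_ext0 [simp]: "map_ext (\<rho> i) (ext0 f) = ext0 (\<rho> i f)"
  by (simp add: vec_eq_iff ext0_def axis_nth rho_0)

lemma map_rho_gen [simp]: "map_ext (\<rho> i) (gen j) = 0"
  by (simp add: vec_eq_iff axis_nth rho_0 rho_1)

lemma ad_gen: "ad i (gen j) = ext1 (b i j)"
  by (simp add: frame_ad_def if_distrib[of "\<lambda>x. _ \<^bold>\<and> x"] cong: if_cong)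

lemma ad_ext0: "ad i (ext0 f) = ext0 (\<rho> i f)"
  by (simp add: frame_ad_def)

lemma sch_gen: "sch (gen i) y = ad i y"
proof -
  have skew: "ext1 (b j i) = - ext1 (b i j)" for j
    by (subst b_skew) (simp add: ext1_alt vec_scale_simps sum_negf)
  have "sch (gen i) y = map_ext (\<rho> i) y - (\<Sum>j\<in>UNIV. ext1 (b j i) \<^bold>\<and> contract j y)"
    by (simp add: frame_schouten_def ad_gen sum_subtractf if_distrib[of grade_involution]
        if_distrib[of "\<lambda>x. x \<^bold>\<and> _"] cong: if_cong)
  then show ?thesis by (simp add: skew frame_ad_def wedge_linear sum_negf)
qed

lemma sch_ext0_right: "sch x (ext0 f) = (\<Sum>i\<in>UNIV. \<rho> i f *s grade_involution (contract i x))"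
  by (simp add: frame_schouten_def)

lemma sch_ext0_gen: "sch (ext0 f) (gen i) = - ext0 (\<rho> i f)"
  using sch_skew[OF ext0_parity gen_parity] by (simp add: sch_gen ad_ext0)

lemma sch_ext0_ext0 [simp]: "sch (ext0 f) (ext0 g) = 0"
  by (simp add: sch_ext0_right)

lemma sch_ext1_ext0: "sch (ext1 u) (ext0 f) = ext0 (\<Sum>i\<in>UNIV. u $ i * \<rho> i f)"
  by (simp add: sch_ext0_right ext0_sum ext0_scale mult.commute)

lemma sch_ext0_ext1: "sch (ext0 f) (ext1 u) = - ext0 (\<Sum>i\<in>UNIV. u $ i * \<rho> i f)"
  using sch_skew[OF ext0_parity ext1_parity] by (simp add: sch_ext1_ext0)

lemma sch_ext1_gen: "sch (ext1 u) (gen j) = - ad j (ext1 u)"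
  using sch_skew[OF ext1_parity gen_parity] by (simp add: sch_gen)

text \<open>The defect of \<open>D\<close> is a derivation in its second argument and graded symmetric, so it
  vanishes if it does on generators.\<close>

lemma derivation_schouten:
  fixes D :: "('a, 'i) ext \<Rightarrow> ('a, 'i) ext"
  assumes D: "ext_derivation p D"
    and ext0_ext0: "\<And>f g. D (sch (ext0 f) (ext0 g)) =
      sch (D (ext0 f)) (ext0 g) + (- 1) ^ p *s sch (ext0 f) (D (ext0 g))"
    and gen_ext0: "\<And>i f. D (sch (gen i) (ext0 f)) =
      sch (D (gen i)) (ext0 f) + sch (gen i) (D (ext0 f))"
    and gen_gen: "\<And>i j. D (sch (gen i) (gen j)) = sch (D (gen i)) (gen j) + sch (gen i) (D (gen j))"
    and x: "x \<in> ext_parity k"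
  shows "D (sch x y) = sch (D x) y + (- 1) ^ (p * (k + 1)) *s sch x (D y)"
proof -
  define K where "K k x y = D (sch x y) - (- 1) ^ (p * (k + 1)) *s sch x (D y) - sch (D x) y"
    for k :: nat and x y
  have K_derivation: "ext_derivation (p + Suc k) (K k x)" if x: "x \<in> ext_parity k" for k x
  proof -
    have "ext_derivation (p + Suc k) (sch (D x))"
      using sch_derivation[OF ext_derivation_parity[OF D x]]
      by (rule ext_derivation_parity_cong) (simp, blast)
    from ext_derivation_subtract[OF ext_derivation_commutator[OF D sch_derivation[OF x]] this]
    show ?thesis by (simp add: K_def[abs_def])
  qed
  have K_skew: "K l y x = - ((- 1) ^ ((k + 1) * (l + 1)) *s K k x y)"
    if x: "x \<in> ext_parity k" and y: "y \<in> ext_parity l" for k l x y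
  proof -
    note skew = sch_skew[OF y x] sch_skew[OF y ext_derivation_parity[OF D x]]
      sch_skew[OF ext_derivation_parity[OF D y] x]
    show ?thesis
      unfolding K_def skew
      by (cases "even p"; cases "even k"; cases "even l")
        (simp_all add: minus_one_power_iff ext_derivation_minus[OF D] vec_scale_simps)
  qed
  have K_skew_0: "K l y x = 0" if "K k x y = 0" "x \<in> ext_parity k" "y \<in> ext_parity l" for k l x y
    using K_skew[OF that(2,3)] that(1) by simp
  have "K 0 (ext0 f) (ext0 g) = 0" "K 1 (gen i) (ext0 f) = 0" "K 1 (gen i) (gen j) = 0" for f g i j
    unfolding K_def ext0_ext0 gen_ext0 gen_gen by simp_all
  note gens = this K_skew_0[OF this(2) gen_parity[folded One_nat_def] ext0_parity]
  \<comment> \<open>The derivation property is used twice: here to pass from generators to any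
    second argument, and after an exchange of the arguments to do the same for any
    \<open>x\<close>.\<close>
  have ext0: "K 0 (ext0 f) y = 0" and gen: "K 1 (gen i) y = 0" for f i y
    by (rule ext_derivation_eq_0[OF K_derivation[OF ext0_parity]]
        ext_derivation_eq_0[OF K_derivation[OF gen_parity[folded One_nat_def]]]; rule gens)+
  have "K k x (ext0 f) = 0" "K k x (gen i) = 0" for f i
    using K_skew_0[OF ext0 ext0_parity x] K_skew_0[OF gen gen_parity[folded One_nat_def] x]
    by simp_all
  then have "K k x y = 0"
    by (rule ext_derivation_eq_0[OF K_derivation[OF x]])
  then show ?thesis by (simp add: K_def diff_eq_eq)
qed

text \<open>Graded skew symmetry matches the three terms of the two cyclic arrangements up to signs,
  and the signs depend only on the parities of \<open>k\<close>, \<open>l\<close> and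
  \<open>m\<close>.\<close>

lemma sch_jacobi_cyclic:
  assumes x: "x \<in> ext_parity k" and y: "y \<in> ext_parity l" and z: "z \<in> ext_parity m"
    and "sch y (sch z x) = sch (sch y z) x + (- 1) ^ ((l + 1) * (m + 1)) *s sch z (sch y x)"
  shows "sch x (sch y z) = sch (sch x y) z + (- 1) ^ ((k + 1) * (l + 1)) *s sch y (sch x z)"
proof -
  note minus = ext_derivation_minus[OF sch_derivation[OF x]]
    ext_derivation_minus[OF sch_derivation[OF y]] ext_derivation_minus[OF sch_derivation[OF z]]
  have "sch y (sch z x) = (- 1) ^ (k * m + k + m) *s sch y (sch x z)"
    by (subst sch_skew[OF z x], cases "even k"; cases "even m")
      (simp_all add: minus_one_power_iff minus vec_scale_simps)
  moreover have "sch (sch y z) x = - ((- 1) ^ ((k + 1) * (l + m)) *s sch x (sch y z))"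
    by (subst sch_skew[OF sch_parity[OF y z] x], cases "even k"; cases "even l"; cases "even m")
      (simp_all add: minus_one_power_iff)
  moreover have "sch z (sch y x) = (- 1) ^ (k * l + k + l + (m + 1) * (k + l)) *s
      - sch (sch x y) z"
    by (subst sch_skew[OF y x], cases "even k"; cases "even l"; cases "even m")
      (simp_all add: minus_one_power_iff minus vec_scale_simps sch_skew[OF sch_parity[OF x y] z])
  ultimately show ?thesis
    using assms(4)
    by (cases "even k"; cases "even l"; cases "even m")
      (simp_all add: minus_one_power_iff vec_scale_simps algebra_simps)
qed

lemma ad_scale: "ad i (f *s x) = \<rho> i f *s x + f *s ad i x"
  by (simp add: ext_derivation_scale[OF ad_derivation] ad_ext0)

text \<open>The identity says that \<open>sch x\<close> is a derivation of the bracket. It is known for three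
  generators, hence if \<open>x\<close> is a generator; a cyclic permutation then gives it for any \<open>x\<close> and two
  generators.\<close>

lemma sch_jacobi:
  assumes x: "x \<in> ext_parity k" and y: "y \<in> ext_parity l"
  shows "sch x (sch y z) = sch (sch x y) z + (- 1) ^ ((k + 1) * (l + 1)) *s sch y (sch x z)"
proof -
  have zero: "sch 0 y = 0" "sch y 0 = 0" for y
    using sch_add_left[of 0 0 y] sch_add_right[of y 0 0] by simp_all
  have minus: "sch (- x) y = - sch x y" "sch x (- y) = - sch x y" for x y
    using additive_minus[of "\<lambda>x. sch x y"] additive_minus[of "sch x"]
    by (simp_all add: sch_add_left sch_add_right)
  \<comment> \<open>On two basis vectors the rule is \<open>rho_bracket\<close>; on the other pairs
    of generators both sides vanish.\<close>
  have ext0: "sch (ext0 f) (sch y z) =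
      sch (sch (ext0 f) y) z + (- 1) ^ (Suc 0 * (l + 1)) *s sch y (sch (ext0 f) z)"
    if "y \<in> ext_parity l" for f y l z
  proof (rule derivation_schouten[OF sch_derivation[OF ext0_parity] _ _ _ that])
    fix i j
    show "sch (ext0 f) (sch (gen i) (gen j)) =
        sch (sch (ext0 f) (gen i)) (gen j) + sch (gen i) (sch (ext0 f) (gen j))"
      by (simp add: sch_gen ad_gen ad_ext0 sch_ext0_gen sch_ext0_ext1 minus
          ext_derivation_minus[OF ad_derivation] ext0_diff flip: rho_bracket)
  qed (simp_all add: sch_gen ad_ext0 sch_ext0_gen zero flip: ext0_minus)
  \<comment> \<open>On a basis vector and a function the rule is \<open>rho_bracket\<close>, on two
    basis vectors it is \<open>b_jacobi\<close>.\<close>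
  have gen: "sch (gen m) (sch y z) =
      sch (sch (gen m) y) z + (- 1) ^ (2 * (l + 1)) *s sch y (sch (gen m) z)"
    if "y \<in> ext_parity l" for m y l z
  proof (rule derivation_schouten[OF _ _ _ _ that])
    show "ext_derivation 2 (sch (gen m))"
      using sch_derivation[OF gen_parity] by (simp add: numeral_2_eq_2)
    fix i j f
    show "sch (gen m) (sch (gen i) (ext0 f)) =
        sch (sch (gen m) (gen i)) (ext0 f) + sch (gen i) (sch (gen m) (ext0 f))"
      by (simp add: sch_gen ad_gen ad_ext0 sch_ext1_ext0 ext0_diff flip: rho_bracket)
    have "ext1 (b m j) = - ext1 (b j m)"
      by (subst b_skew) (simp add: ext1_alt vec_scale_simps sum_negf)
    moreover have "u = - w + - v" if "u + v + w = 0" for u v w :: "('a, 'i) ext"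
    proof -
      have "u = (u + v + w) + (- w + - v)" by simp
      then show ?thesis using that by simp
    qed
    from this[OF b_jacobi[of m i j]] have "ad m (ext1 (b i j)) =
        - ad j (ext1 (b m i)) + - ad i (ext1 (b j m))" .
    ultimately show "sch (gen m) (sch (gen i) (gen j)) =
        sch (sch (gen m) (gen i)) (gen j) + sch (gen i) (sch (gen m) (gen j))"
      by (simp add: sch_gen ad_gen sch_ext1_gen ext_derivation_minus[OF ad_derivation])
  qed (simp_all add: sch_gen ad_ext0 ext_derivation_0[OF ad_derivation])
  have ext0': "sch (ext0 f) (sch y z) =
      sch (sch (ext0 f) y) z + (- 1) ^ ((0 + 1) * (l + 1)) *s sch y (sch (ext0 f) z)"
    if "y \<in> ext_parity l" for f y l z
    using ext0[OF that, of f z] by simp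
  have gen': "sch (gen m) (sch y z) =
      sch (sch (gen m) y) z + (- 1) ^ ((Suc 0 + 1) * (l + 1)) *s sch y (sch (gen m) z)"
    if "y \<in> ext_parity l" for m y l z
    using gen[OF that, of m z] by simp
  have "sch x (sch y z) = sch (sch x y) z + (- 1) ^ (Suc k * (l + 1)) *s sch y (sch x z)"
  proof (rule derivation_schouten[OF sch_derivation[OF x] _ _ _ y])
    fix f g i j
    show "sch x (sch (ext0 f) (ext0 g)) =
        sch (sch x (ext0 f)) (ext0 g) + (- 1) ^ Suc k *s sch (ext0 f) (sch x (ext0 g))"
      using sch_jacobi_cyclic[OF x ext0_parity ext0_parity ext0'[OF ext0_parity]] by simp
    show "sch x (sch (gen i) (ext0 g)) =
        sch (sch x (gen i)) (ext0 g) + sch (gen i) (sch x (ext0 g))"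
      using sch_jacobi_cyclic[OF x gen_parity ext0_parity gen'[OF ext0_parity]] by simp
    show "sch x (sch (gen i) (gen j)) =
        sch (sch x (gen i)) (gen j) + sch (gen i) (sch x (gen j))"
      using sch_jacobi_cyclic[OF x gen_parity gen_parity gen'[OF gen_parity]] by simp
  qed
  then show ?thesis by simp
qed

lemma ad_grade: "x \<in> ext_grade k \<Longrightarrow> ad i x \<in> ext_grade k"
  unfolding frame_ad_def
proof (intro ext_grade_add map_ext_grade ext_grade_sum)
  fix j assume x: "x \<in> ext_grade k"
  show "ext1 (b i j) \<^bold>\<and> contract j x \<in> ext_grade k"
  proof (cases k)
    case 0
    then show ?thesis using x by (simp add: contract_grade_0)
  next
    case (Suc l)
    then show ?thesis using ext_grade_wedge[OF ext1_grade contract_grade, of x l] x by simp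
  qed
qed (rule rho_0)

lemma sch_grade:
  assumes x: "x \<in> ext_grade k" and y: "y \<in> ext_grade l" and "1 \<le> k + l"
  shows "sch x y \<in> ext_grade (k + l - 1)"
  unfolding frame_schouten_def
proof (intro ext_grade_sum ext_grade_diff)
  fix i
  show "grade_involution (contract i x) \<^bold>\<and> map_ext (\<rho> i) y \<in> ext_grade (k + l - 1)"
  proof (cases k)
    case 0
    then show ?thesis using x by (simp add: contract_grade_0)
  next
    case (Suc m)
    then have m: "contract i x \<in> ext_grade m" using contract_grade x by auto
    then have "grade_involution (contract i x) \<in> ext_grade m"
      by (simp add: grade_involution_parity[OF ext_grade_parity[OF m]] ext_grade_scale)
    moreover have "map_ext (\<rho> i) y \<in> ext_grade l" using map_ext_grade[of "\<rho> i"] rho_0 y by blast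
    ultimately show ?thesis
      using ext_grade_wedge Suc by fastforce
  qed
  show "ad i x \<^bold>\<and> contract i y \<in> ext_grade (k + l - 1)"
  proof (cases l)
    case 0
    then show ?thesis using y by (simp add: contract_grade_0)
  next
    case (Suc m)
    then show ?thesis using ext_grade_wedge[OF ad_grade[OF x] contract_grade, of y m] y by simp
  qed
qed

text \<open>Provides the witness for the definite description \<open>schouten\<close>. By
  \<open>rho_scale\<close> the scalars of the field are constants for the anchor, which is what
  makes the bracket bilinear over the field.\<close>

lemma is_schouten_frame:
  assumes rho_scale: "\<And>i c. \<rho> i (scaleA c 1) = 0"
    and bracket: "\<And>u v. ext1 (bracket u v) = sch (ext1 u) (ext1 v)"
    and anchor: "\<And>u f. anchor u f = (\<Sum>i\<in>UNIV. u $ i * \<rho> i f)"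
  shows "is_schouten scaleA bracket anchor sch"
proof -
  have map_scale: "map_ext (\<rho> i) (scaleA c 1 *s x) = scaleA c 1 *s map_ext (\<rho> i) x" for i c x
    by (simp add: vec_eq_iff rho_mult rho_scale)
  have scale_left: "sch (scaleA c 1 *s x) y = scaleA c 1 *s sch x y" for c x y
    by (simp add: frame_schouten_def ad_scale rho_scale contract_scale grade_involution_scale
        wedge_linear vec_scale_simps)
  have scale_right: "sch x (scaleA c 1 *s y) = scaleA c 1 *s sch x y" for c x y
    by (simp add: frame_schouten_def map_scale contract_scale wedge_linear vec_scale_simps)
  have zero: "sch x y = 0" if "x \<in> ext_grade 0" "y \<in> ext_grade 0" for x y
    using sch_ext0_ext0[of "x $ {}" "y $ {}"] that by (simp flip: ext_grade_0_ext0)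
  have wedge: "sch x (y \<^bold>\<and> z) = sch x y \<^bold>\<and> z + (- 1) ^ ((k + 1) * l) *s (y \<^bold>\<and> sch x z)"
    if "x \<in> ext_grade k" "y \<in> ext_grade l" for x y z k l
    using ext_derivation_wedge[OF sch_derivation, OF that[THEN ext_grade_parity]] by simp
  show ?thesis
    unfolding is_schouten_def
    by (intro conjI allI ballI impI)
      (rule sch_add_left sch_add_right scale_left scale_right
       | (rule zero sch_grade wedge; assumption)
       | (rule sch_skew sch_jacobi; erule ext_grade_parity)
       | simp add: bracket anchor sch_ext1_ext0)+
qed

end

subsection \<open>Uniqueness of the Schouten bracket\<close>

context
  fixes scaleA :: "'k::field \<Rightarrow> 'a::comm_ring_1 \<Rightarrow> 'a"
    and bracket :: "('a, 'i::{finite,linorder}) vec \<Rightarrow> ('a, 'i) vec \<Rightarrow> ('a, 'i) vec"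
    and anchor :: "('a, 'i) vec \<Rightarrow> 'a \<Rightarrow> 'a"
    and s :: "('a, 'i) ext \<Rightarrow> ('a, 'i) ext \<Rightarrow> ('a, 'i) ext"
  assumes s: "is_schouten scaleA bracket anchor s"
begin

lemma is_schouten_add: "s (x + y) z = s x z + s y z" "s x (y + z) = s x y + s x z"
  using s unfolding is_schouten_def by simp_all

lemma is_schouten_scale:
  "s (scaleA c 1 *s x) y = scaleA c 1 *s s x y" "s x (scaleA c 1 *s y) = scaleA c 1 *s s x y"
  using s unfolding is_schouten_def by simp_all

lemma is_schouten_0_0: "x \<in> ext_grade 0 \<Longrightarrow> y \<in> ext_grade 0 \<Longrightarrow> s x y = 0"
  using s unfolding is_schouten_def by simp

lemma is_schouten_grade:
  "x \<in> ext_grade k \<Longrightarrow> y \<in> ext_grade l \<Longrightarrow> 1 \<le> k + l \<Longrightarrow> s x y \<in> ext_grade (k + l - 1)"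
  using s unfolding is_schouten_def by meson

lemma is_schouten_skew:
  "x \<in> ext_grade k \<Longrightarrow> y \<in> ext_grade l \<Longrightarrow> s x y = - ((- 1) ^ ((k + 1) * (l + 1)) *s s y x)"
  using s unfolding is_schouten_def by meson

lemma is_schouten_jacobi:
  "x \<in> ext_grade k \<Longrightarrow> y \<in> ext_grade l \<Longrightarrow>
    s x (s y z) = s (s x y) z + (- 1) ^ ((k + 1) * (l + 1)) *s s y (s x z)"
  using s unfolding is_schouten_def by meson

lemma is_schouten_wedge:
  "x \<in> ext_grade k \<Longrightarrow> y \<in> ext_grade l \<Longrightarrow>
    s x (y \<^bold>\<and> z) = s x y \<^bold>\<and> z + (- 1) ^ ((k + 1) * l) *s (y \<^bold>\<and> s x z)"
  using s unfolding is_schouten_def by meson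

lemma is_schouten_bracket: "s (ext1 u) (ext1 v) = ext1 (bracket u v)"
  and is_schouten_anchor: "s (ext1 u) (ext0 a) = ext0 (anchor u a)"
  using s unfolding is_schouten_def by simp_all

lemma is_schouten_derivation:
  assumes x: "x \<in> ext_grade k"
  shows "ext_derivation (k + 1) (s x)"
proof (rule ext_derivation_gradeI)
  fix l and y :: "('a, 'i) ext" assume y: "y \<in> ext_grade l"
  show "s x y \<in> ext_parity (l + (k + 1))"
  \<comment> \<open>For \<open>k = l = 0\<close> truncated subtraction would turn the grade -1 into
    0, so the axiom that functions commute must supply the parity.\<close>
  proof (cases "k + l \<ge> 1")
    case True
    then have "s x y \<in> ext_grade (k + l - 1)"
      using is_schouten_grade x y by blast
    moreover have "even (k + l - 1) = even (l + (k + 1))" using True by auto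
    ultimately show ?thesis using ext_grade_parity ext_parity_cong by blast
  next
    case False
    then have "k = 0" "l = 0" by auto
    then show ?thesis using is_schouten_0_0 x y by simp
  qed
qed (use x in \<open>simp_all add: is_schouten_add is_schouten_wedge\<close>)

end

text \<open>Two brackets agree on pairs of generators. Both are derivations in the second argument,
  so agreement spreads there; skew symmetry exchanges the arguments, and it spreads again. Skew
  symmetry needs homogeneous arguments, so the general first argument is reached last, by
  additivity.\<close>

lemma is_schouten_unique:
  fixes s s' :: "('a::comm_ring_1, 'i::{finite,linorder}) ext \<Rightarrow> ('a, 'i) ext \<Rightarrow> ('a, 'i) ext"
  assumes s: "is_schouten scaleA bracket anchor s" and s': "is_schouten scaleA bracket anchor s'"
  shows "s = s'"
proof (intro ext)
  fix x y
  have skew: "s x y = s' x y" if "s y x = s' y x" "x \<in> ext_grade k" "y \<in> ext_grade l" for x y k l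
    using is_schouten_skew[OF s that(2,3)] is_schouten_skew[OF s' that(2,3)] that(1) by simp
  have eqI: "s x y = s' x y" if "x \<in> ext_grade k" "\<And>f. s x (ext0 f) = s' x (ext0 f)"
    "\<And>i. s x (gen i) = s' x (gen i)" for x y k
    using ext_derivation_eqI[OF is_schouten_derivation[OF s that(1)]
        is_schouten_derivation[OF s' that(1)]] that(2,3) by simp
  have 1: "s (ext0 f) (ext0 g) = s' (ext0 f) (ext0 g)" for f g
    by (simp add: is_schouten_0_0[OF s] is_schouten_0_0[OF s'] ext0_grade)
  have 2: "s (gen i) (ext0 f) = s' (gen i) (ext0 f)" "s (gen i) (gen j) = s' (gen i) (gen j)" for i j f
    unfolding gen_eq_ext1 by (simp_all add: is_schouten_bracket[OF s] is_schouten_bracket[OF s']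
        is_schouten_anchor[OF s] is_schouten_anchor[OF s'])
  have ext0: "s (ext0 f) y = s' (ext0 f) y" for f y
    by (rule eqI[OF ext0_grade 1 skew[OF 2(1) ext0_grade gen_grade]])
  have gen: "s (gen i) y = s' (gen i) y" for i y
    by (rule eqI[OF gen_grade 2])
  have "s (axis S a) y = s' (axis S a) y" for S a
    by (rule eqI[OF ext_grade_axis])
      (rule skew[OF ext0 ext_grade_axis ext0_grade] skew[OF gen ext_grade_axis gen_grade])+
  then show "s x y = s' x y"
    by (induction x rule: vec_induct) (simp_all add: is_schouten_add[OF s] is_schouten_add[OF s'])
qed

lemma schouten_eqI:
  assumes "is_schouten scaleA bracket anchor s"
  shows "schouten scaleA bracket anchor = s"
  unfolding schouten_def using assms is_schouten_unique by (intro the_equality) blast+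

section \<open>From the Schouten bracket back to the axioms of a Lie Rinehart algebra\<close>

lemma module_vec: "module ((*s) :: 'a::comm_ring_1 \<Rightarrow> ('a, 'n::finite) vec \<Rightarrow> ('a, 'n) vec)"
  by standard (simp_all add: vec_scale_simps)

text \<open>Since \<open>ext0\<close> and \<open>ext1\<close> are injective, the axioms can be read
  off from the bracket identities in grades 0 and 1. The exception is \<open>self\<close>: graded
  skew symmetry yields only that twice \<open>bracket u u\<close> is 0.\<close>

lemma is_schouten_lie_rinehart_algebra:
  fixes bracket :: "('a::comm_ring_1, 'i::{finite,linorder}) vec \<Rightarrow> ('a, 'i) vec \<Rightarrow> ('a, 'i) vec"
  assumes s: "is_schouten scaleA bracket anchor s" and A: "comm_algebra scaleA"
    and self: "\<And>u. bracket u u = 0"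
  shows "lie_rinehart_algebra scaleA (*s) bracket anchor"
proof -
  interpret A: comm_algebra scaleA by fact
  have scaleA_mult_1: "scaleA (c * d) 1 = scaleA c 1 * scaleA d 1" for c d
    using A.scaleA_mult[of c 1 "scaleA d 1"] by simp
  interpret V: vector_space "\<lambda>c. (*s) (scaleA c 1) :: ('a, 'i) vec \<Rightarrow> _"
    by standard (simp_all add: vec_scale_simps scaleA_mult_1 A.scale_left_distrib)
  note add = is_schouten_add[OF s] and scale = is_schouten_scale[OF s]
    and br = is_schouten_bracket[OF s] and an = is_schouten_anchor[OF s]
    and skew = is_schouten_skew[OF s] and jac = is_schouten_jacobi[OF s]
    and der = is_schouten_wedge[OF s]
  have minus: "s x (- y) = - s x y" for x y
    using add(2) by (rule additive_minus)
  have 00: "s (ext0 f) (ext0 g) = 0" for f g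
    using is_schouten_0_0[OF s ext0_grade ext0_grade] .
  have bracket_skew: "bracket u v = - bracket v u" for u v
    using skew[OF ext1_grade ext1_grade, of u v] 
    by (simp add: br flip: ext1_eq_iff) (simp add: ext1_alt vec_scale_simps sum_negf)
  have bracket_add_right: "bracket u (v + w) = bracket u v + bracket u w" for u v w
    by (simp add: ext1_linear add flip: ext1_eq_iff br)
  have bracket_minus_right: "bracket u (- v) = - bracket u v" for u v
    using bracket_add_right by (rule additive_minus)
  have "lie_algebra (\<lambda>c. (*s) (scaleA c 1)) bracket"
  proof
    fix u v w c
    show "bracket (u + v) w = bracket u w + bracket v w"
      and "bracket (scaleA c 1 *s u) v = scaleA c 1 *s bracket u v"
      and "bracket u (scaleA c 1 *s v) = scaleA c 1 *s bracket u v"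
      by (simp_all add: ext1_linear add scale flip: ext1_eq_iff br)
    have "bracket u (bracket v w) = bracket (bracket u v) w + bracket v (bracket u w)"
      using jac[OF ext1_grade ext1_grade, of u v "ext1 w"]
      by (simp add: ext1_linear br flip: ext1_eq_iff)
    also have "bracket (bracket u v) w = - bracket w (bracket u v)"
      by (rule bracket_skew)
    also have "bracket v (bracket u w) = - bracket v (bracket w u)"
      by (subst bracket_skew[of u w]) (rule bracket_minus_right)
    finally show "bracket u (bracket v w) + bracket v (bracket w u) + bracket w (bracket u v) = 0"
      by simp
  qed (fact bracket_add_right self)+
  then interpret L: lie_algebra "\<lambda>c. (*s) (scaleA c 1)" bracket .
  interpret M: module "(*s) :: 'a \<Rightarrow> ('a, 'i) vec \<Rightarrow> _" by (rule module_vec)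
  have mult: "ext0 (f * g) = ext0 f \<^bold>\<and> ext0 g" for f g :: 'a
    by simp (simp add: ext0_def axis_def vec_eq_iff)
  have ext0_inj: "f = g" if "ext0 f = (ext0 g :: ('a, 'i) ext)" for f g
    using that by simp
  show ?thesis
  proof
    fix u v :: "('a, 'i) vec" and f g :: 'a
    show "derivation scaleA (anchor u)"
      unfolding derivation_def
    proof (intro conjI allI Vector_Spaces.linear_iff[THEN iffD2])
      show "vector_space scaleA" "vector_space scaleA" by (fact A.vector_space_axioms)+
      fix a c d
      show "anchor u (a + d) = anchor u a + anchor u d"
        by (rule ext0_inj) (simp add: add ext0_add flip: an)
      show "anchor u (a * d) = anchor u a * d + a * anchor u d"
        using der[OF ext1_grade ext0_grade, of u a "ext0 d"]
        by (intro ext0_inj) (simp add: mult ext0_add flip: an del: wedge_ext0_left wedge_ext0_right)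
      have "scaleA c a = scaleA c 1 * a" "scaleA c (anchor u a) = scaleA c 1 * anchor u a"
        using A.scaleA_mult[of c 1 a] A.scaleA_mult[of c 1 "anchor u a"]
        by (simp_all only: mult_1_left)
      then show "anchor u (scaleA c a) = scaleA c (anchor u a)"
        using scale(2)[of "ext1 u" c "ext0 a"] by (intro ext0_inj) (simp add: mult flip: an del: wedge_ext0_right)
    qed
    show "anchor (u + v) f = anchor u f + anchor v f"
      by (rule ext0_inj) (simp add: add ext0_add ext1_linear flip: an)
    \<comment> \<open>The Leibniz rule for the bracket of \<open>f\<close> with
      \<open>g \<and> u\<close>: the bracket of \<open>f\<close> and \<open>g\<close> vanishes, so
      \<open>g\<close> comes out as a factor.\<close>
    show "anchor (g *s u) f = g * anchor u f"
      using der[OF ext0_grade ext0_grade, of f g "ext1 u"] skew[OF ext0_grade ext1_grade, of f u]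
        skew[OF ext0_grade ext1_grade, of f "g *s u"] an[of "g *s u" f]
      by (intro ext0_inj) (simp add: 00 an ext1_linear vec_scale_simps mult del: wedge_ext0_right)
    show "anchor (bracket u v) f = anchor u (anchor v f) - anchor v (anchor u f)"
      using jac[OF ext1_grade ext1_grade, of u v "ext0 f"]
      by (intro ext0_inj) (simp add: an br ext0_diff)
    show "bracket u (f *s v) = f *s bracket u v + anchor u f *s v"
      using der[OF ext1_grade ext0_grade, of u f "ext1 v"] br[of u "f *s v"]
      by (simp add: an br ext1_linear add.commute flip: ext1_eq_iff)
  qed
qed

text \<open>Once equivalence of pairs is known to be equality of their differentials, this settles
  transitivity and the bijection from the quotient to the image in one stroke.\<close>

lemma equiv_kernel:
  fixes F :: "'a \<Rightarrow> 'b"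
  assumes r: "r = {(x, y). x \<in> A \<and> y \<in> A \<and> F x = F y}"
  shows "equiv A r" and "\<exists>\<Phi>. bij_betw \<Phi> (A // r) (F ` A) \<and> (\<forall>C\<in>A // r. \<forall>x\<in>C. \<Phi> C = F x)"
proof -
  show eq: "equiv A r"
    unfolding r by (auto intro!: equivI refl_onI symI transI)
  have cls: "r `` {x} = {y \<in> A. F x = F y}" if "x \<in> A" for x
    using that by (auto simp: r)
  define \<Phi> where "\<Phi> C = F (SOME x. x \<in> C)" for C
  have \<Phi>_class: "\<Phi> (r `` {x}) = F x" if "x \<in> A" for x
  proof -
    have "(SOME y. y \<in> r `` {x}) \<in> r `` {x}"
      by (rule someI[of _ x]) (use that in \<open>simp add: r\<close>)
    then show ?thesis using that by (simp add: \<Phi>_def cls)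
  qed
  then have "\<forall>C\<in>A // r. \<forall>x\<in>C. \<Phi> C = F x"
    by (auto elim!: quotientE simp: \<Phi>_class) (auto simp: r)
  moreover have "inj_on \<Phi> (A // r)"
    by (rule inj_onI) (auto elim!: quotientE simp: \<Phi>_class, auto simp: r)
  moreover have "\<Phi> ` (A // r) = F ` A"
    by (auto simp: quotient_def \<Phi>_class image_iff)
  ultimately show "\<exists>\<Phi>. bij_betw \<Phi> (A // r) (F ` A) \<and> (\<forall>C\<in>A // r. \<forall>x\<in>C. \<Phi> C = F x)"
    unfolding bij_betw_def by blast
qed

subsection \<open>The crossed product\<close>

lemma contract_axis:
  fixes S :: "'i::{finite,linorder} set"
  shows "contract i (axis S (1 :: 'a::comm_ring_1)) =
    (if i \<in> S then (- 1) ^ card {j \<in> S. j < i} *s (axis {j \<in> S. j < i} 1 \<^bold>\<and> axis {j \<in> S. i < j} 1)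
     else 0)"
proof (cases "i \<in> S")
  case False
  then show ?thesis by (auto simp: vec_eq_iff contract_nth axis_nth)
next
  case True
  let ?L = "{j \<in> S. j < i}" and ?R = "{j \<in> S. i < j}"
  have "?L \<union> ?R = S - {i}" using True by auto
  moreover have "{(k, j). k \<in> ?L \<and> j \<in> ?R \<and> j < k} = {}" by auto
  then have "shuffle_sign ?L ?R = (1 :: 'a)" by (simp only: shuffle_sign_def card.empty power_0)
  moreover have "?L \<inter> ?R = {}" by auto
  ultimately have LR: "axis ?L 1 \<^bold>\<and> axis ?R (1 :: 'a) = axis (S - {i}) 1"
    by (simp add: wedge_axis)
  have "{(k, j). k \<in> {i} \<and> j \<in> S - {i} \<and> j < k} = Pair i ` ?L" by auto
  then have sign: "shuffle_sign {i} (S - {i}) = (- 1 :: 'a) ^ card ?L"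
    by (simp only: shuffle_sign_def) (simp add: card_image inj_on_def)
  have "contract i (axis S 1) = shuffle_sign {i} (S - {i}) *s axis (S - {i}) (1 :: 'a)"
  proof (rule vec_eq_iff[THEN iffD2], rule allI)
    fix U
    have "insert i U = S \<longleftrightarrow> U = S - {i}" if "i \<notin> U" using that True by auto
    then show "contract i (axis S 1) $ U = (shuffle_sign {i} (S - {i}) *s axis (S - {i}) (1 :: 'a)) $ U"
      by (simp add: contract_nth axis_nth)
  qed
  then show ?thesis
    using True by (simp add: LR sign)
qed

text \<open>The values \<open>\<Omega> (e i)\<close> are even and can be moved to the front without
  a sign; the sign left over is that of the contraction. In this form the extension is visibly a
  derivation that kills functions.\<close>

lemma extend_eq:
  fixes \<Omega> :: "'g \<Rightarrow> ('k::field poly, 'i::{finite,linorder}) ext"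
  assumes "\<And>i. \<Omega> (e i) \<in> ext_parity 0"
  shows "extend e \<Omega> x = (\<Sum>i\<in>UNIV. \<Omega> (e i) \<^bold>\<and> contract i x)"
proof -
  have "(\<Sum>i\<in>S. (- 1) ^ card {j \<in> S. j < i} *s
      (axis {j \<in> S. j < i} 1 \<^bold>\<and> \<Omega> (e i) \<^bold>\<and> axis {j \<in> S. i < j} 1)) =
      (\<Sum>i\<in>UNIV. \<Omega> (e i) \<^bold>\<and> contract i (axis S 1))" for S
  proof (rule sum.mono_neutral_cong_left)
    fix i assume "i \<in> S"
    have "axis {j \<in> S. j < i} 1 \<^bold>\<and> \<Omega> (e i) = \<Omega> (e i) \<^bold>\<and> axis {j \<in> S. j < i} 1"
      using wedge_commute[OF ext_grade_parity[OF ext_grade_axis] assms] by simp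
    then show "(- 1) ^ card {j \<in> S. j < i} *s
        (axis {j \<in> S. j < i} 1 \<^bold>\<and> \<Omega> (e i) \<^bold>\<and> axis {j \<in> S. i < j} 1) =
        \<Omega> (e i) \<^bold>\<and> contract i (axis S 1)"
      using \<open>i \<in> S\<close> by (simp add: contract_axis wedge_linear wedge_assoc)
  qed (auto simp: contract_axis)
  then have "extend e \<Omega> x = (\<Sum>i\<in>UNIV. \<Omega> (e i) \<^bold>\<and> contract i (\<Sum>S\<in>UNIV. x $ S *s axis S 1))"
    unfolding extend_def
    by (simp add: contract_sum contract_scale wedge_linear vec_scale_simps)
      (rule sum.swap)
  also have "(\<Sum>S\<in>UNIV. x $ S *s axis S 1) = x"
    by (simp add: vec_eq_iff axis_def if_distrib[of "\<lambda>a. _ * a"] cong: if_cong)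
  finally show ?thesis .
qed

text \<open>The Leibniz rule applied to \<open>f = c + t g\<close>, with constants killed, leaves
  the value at \<open>t\<close> as the only freedom.\<close>

lemma ext_derivation_ext0_poly:
  fixes D :: "('k::field poly, 'i::{finite,linorder}) ext \<Rightarrow> ('k poly, 'i) ext"
  assumes D: "ext_derivation p D" and const: "\<And>c. D (ext0 [:c:]) = 0"
  shows "D (ext0 f) = pderiv f *s D (ext0 [:0, 1:])"
proof (induction f)
  case 0
  show ?case using const[of 0] by simp
next
  case (pCons c f)
  have "ext0 (pCons c f) = ext0 [:c:] + [:0, 1:] *s (ext0 f :: ('k poly, 'i) ext)"
    by (simp add: ext0_def axis_def vec_eq_iff)
  then have "D (ext0 (pCons c f)) = f *s D (ext0 [:0, 1:]) + [:0, 1:] *s D (ext0 f)"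
    by (simp add: ext_derivation_add[OF D] ext_derivation_scale[OF D] const)
  also have "\<dots> = pderiv (pCons c f) *s D (ext0 [:0, 1:])"
    by (simp add: pCons pderiv_pCons vec_scale_simps)
  finally show ?case .
qed

text \<open>A two-element \<open>S\<close> misses some index \<open>i\<close> as the rank is at
  least 3, and the coefficient of \<open>gen i \<and> w\<close> at \<open>insert i S\<close> is that
  of \<open>w\<close> at \<open>S\<close> up to sign. In rank 2 the top form would be a
  counterexample.\<close>

lemma wedge_gen_eq_0:
  fixes w :: "('a::comm_ring_1, 'i::{finite,linorder}) ext"
  assumes w: "w \<in> ext_grade 2" and "\<And>i. w \<^bold>\<and> gen i = 0" and "3 \<le> card (UNIV :: 'i set)"
  shows "w = 0"
proof (rule vec_eq_iff[THEN iffD2], rule allI)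
  fix S
  show "w $ S = 0 $ S"
  proof (cases "card S = 2")
    case True
    then have "S \<noteq> UNIV" using assms(3) by auto
    then obtain i where i: "i \<notin> S" by blast
    have "gen i \<^bold>\<and> w = 0"
      using wedge_commute[OF gen_parity ext_grade_parity[OF w], of i] assms(2) by simp
    then have "shuffle_sign {i} S * w $ S = 0"
      using wedge_gen_nth[of i w "insert i S"] i by simp
    then have "shuffle_sign {i} S * (shuffle_sign {i} S * w $ S) = 0" by simp
    then show ?thesis by simp
  next
    case False
    then show ?thesis using w by (auto simp: ext_grade_def)
  qed
qed

text \<open>The interior product with the anchor, regarded as a 1-form with values in
  \<open>K[t]\<close>. Up to sign it is the bracket with \<open>t\<close>.\<close>

definition contract_anchor ::
    "('i::{finite,linorder} \<Rightarrow> 'g) \<Rightarrow> ('g \<Rightarrow> 'k::field poly) \<Rightarrow> ('k poly, 'i) ext \<Rightarrow> ('k poly, 'i) ext"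
  where "contract_anchor e \<theta> x = (\<Sum>i\<in>UNIV. \<theta> (e i) *s contract i x)"

lemma contract_anchor_add:
    "contract_anchor e \<theta> (x + y) = contract_anchor e \<theta> x + contract_anchor e \<theta> y"
  and contract_anchor_scale: "contract_anchor e \<theta> (f *s x) = f *s contract_anchor e \<theta> x"
  and contract_anchor_0: "contract_anchor e \<theta> 0 = 0"
  by (simp_all add: contract_anchor_def contract_add contract_scale vec_scale_simps sum.distrib
      mult.commute)

lemma contract_anchor_wedge:
  "contract_anchor e \<theta> (ext1 u \<^bold>\<and> ext1 v) =
    anchor_poly e \<theta> u *s ext1 v - anchor_poly e \<theta> v *s ext1 u"
proof -
  have "contract i (ext1 u \<^bold>\<and> ext1 v) = u $ i *s ext1 v - v $ i *s ext1 u" for i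
    by (simp add: contract_wedge[OF ext_grade_parity[OF ext1_grade]] vec_scale_simps)
  then show ?thesis
    unfolding contract_anchor_def vec_eq_iff
    by (simp add: anchor_poly_def sum_distrib_left sum_subtractf right_diff_distrib mult_ac)
qed

lemma kernel_wedge_D:
  fixes \<nu> :: "('k::field poly, 'i::{finite,linorder}) ext"
  assumes "\<nu> \<in> kernel_wedge e \<theta>"
  shows "\<nu> \<in> ext_grade 2" and "contract_anchor e \<theta> \<nu> = 0"
proof -
  interpret M: module "(*s) :: 'k poly \<Rightarrow> ('k poly, 'i) ext \<Rightarrow> _" by (rule module_vec)
  have "\<nu> \<in> ext_grade 2 \<and> contract_anchor e \<theta> \<nu> = 0"
    using assms unfolding kernel_wedge_def
  proof (induction rule: M.span_induct_alt)
    case (step f x y)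
    then obtain u v where x: "x = ext1 u \<^bold>\<and> ext1 v" and uv: "u \<in> anchor_kernel e \<theta>" "v \<in> anchor_kernel e \<theta>"
      by blast
    have "x \<in> ext_grade 2"
      unfolding x using ext_grade_wedge[OF ext1_grade ext1_grade, of u v] by (simp add: numeral_2_eq_2)
    moreover have "contract_anchor e \<theta> x = 0"
      using uv by (simp add: x contract_anchor_wedge anchor_kernel_def)
    ultimately show ?case
      using step by (simp add: contract_anchor_add contract_anchor_scale ext_grade_add ext_grade_scale)
  qed (simp add: contract_anchor_0)
  then show "\<nu> \<in> ext_grade 2" and "contract_anchor e \<theta> \<nu> = 0" by auto
qed

locale crossed_product =
  fixes scl :: "'k::field_char_0 \<Rightarrow> 'g::ab_group_add \<Rightarrow> 'g" and bracket :: "'g \<Rightarrow> 'g \<Rightarrow> 'g"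
    and e :: "'i::{finite,linorder} \<Rightarrow> 'g" and \<theta> :: "'g \<Rightarrow> 'k poly"
  assumes lie: "lie_algebra scl bracket" and basis: "ordered_basis scl e"
    and action: "lie_action scl bracket \<theta>"
begin

sublocale lie: lie_algebra scl bracket by (rule lie)

sublocale \<theta>: Vector_Spaces.linear scl smult \<theta>
  using action by (simp add: lie_action_def)

abbreviation T where "T \<equiv> tensor scl e 1"

lemma tensor_eq: "tensor scl e f X = f *s T X"
  by (simp add: tensor_def vec_eq_iff)

lemma T_add: "T (X + Y) = T X + T Y"
  by (rule tensor_add_right[OF lie.vector_space_axioms basis])

lemma T_scale: "T (scl c X) = [:c:] *s T X"
  using tensor_scale_right[OF lie.vector_space_axioms basis, of 1 c X] tensor_eq[of "[:c:]" X]
  by simp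

lemma T_sum: "T (sum F I) = (\<Sum>i\<in>I. T (F i))"
  by (rule tensor_sum_right[OF lie.vector_space_axioms basis])

lemma T_basis: "T (e i) = axis i 1"
proof -
  have "lie.independent (range e)" "inj e" using basis by (simp_all add: ordered_basis_def)
  then show ?thesis
    by (simp add: tensor_def lie.representation_basis vec_eq_iff axis_def inj_eq)
qed

abbreviation coord where "coord X i \<equiv> lie.representation (range e) X (e i)"

lemma T_nth: "T X $ i = [:coord X i:]"
  by (simp add: tensor_def)

lemma expand: "(\<Sum>i\<in>UNIV. scl (coord X i) (e i)) = X"
  by (rule ordered_basis_expansion[OF lie.vector_space_axioms basis])

lemma anchor_poly_T: "anchor_poly e \<theta> (T X) = \<theta> X"
  by (subst (2) expand[symmetric]) (simp add: anchor_poly_def T_nth \<theta>.sum \<theta>.scale)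

definition \<rho> where "\<rho> i f = \<theta> (e i) * pderiv f"
definition b where "b i j = T (bracket (e i) (e j))"

lemma bracket_skew: "bracket Y X = - bracket X Y"
proof -
  have "bracket X Y + bracket Y X = bracket (X + Y) (X + Y)"
    by (simp only: lie.bracket_add_left lie.bracket_add_right)
      (simp add: lie.bracket_self add.commute)
  then have "bracket X Y + bracket Y X = 0" by (simp add: lie.bracket_self)
  then show ?thesis by (simp add: add_eq_0_iff)
qed

lemma bracket_sum_right: "bracket X (sum F I) = (\<Sum>i\<in>I. bracket X (F i))"
proof -
  have "bracket X 0 = 0" using lie.bracket_scale_right[of X 0 0] by simp
  then show ?thesis
    by (induction I rule: infinite_finite_induct) (simp_all add: lie.bracket_add_right)
qed

text \<open>Elements of the Lie algebra have constant coefficients, so the differentiating part of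
  \<open>frame_ad\<close> vanishes on them. This reduces the Jacobi identity of the frame to that of
  the Lie algebra.\<close>

lemma frame_ad_ext1_T: "frame_ad \<rho> b i (ext1 (T X)) = ext1 (T (bracket (e i) X))"
proof -
  have "ext1 (T X) $ S = [:0:] \<or> (\<exists>i. ext1 (T X) $ S = T X $ i)" for S
  proof (cases "card S = 1")
    case True
    then obtain i where "S = {i}" by (rule card_1_singletonE)
    then show ?thesis by auto
  next
    case False
    then show ?thesis using ext1_grade[of "T X"] by (auto simp: ext_grade_def)
  qed
  then have "pderiv (ext1 (T X) $ S) = 0" for S
    by (metis T_nth pderiv_singleton)
  then have "map_ext (\<rho> i) (ext1 (T X)) = 0"
    by (simp add: vec_eq_iff \<rho>_def)
  moreover have "ext1 (T (bracket (e i) X)) = (\<Sum>j\<in>UNIV. ext1 (b i j) \<^bold>\<and> contract j (ext1 (T X)))"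
    by (subst expand[of X, symmetric])
      (simp add: bracket_sum_right lie.bracket_scale_right T_sum T_scale ext1_sum ext1_linear T_nth b_def)
  ultimately show ?thesis by (simp add: frame_ad_def)
qed

sublocale lie_rinehart_frame \<rho> b
proof
  fix i j k f g
  show "\<rho> i (f + g) = \<rho> i f + \<rho> i g" "\<rho> i (f * g) = \<rho> i f * g + f * \<rho> i g"
    by (simp_all add: \<rho>_def pderiv_add pderiv_mult algebra_simps)
  show "b j i = - b i j"
    unfolding b_def by (subst bracket_skew) (use T_scale[of "- 1"] in \<open>simp add: vec_eq_iff\<close>)
  have "\<theta> (bracket (e i) (e j)) = \<theta> (e i) * pderiv (\<theta> (e j)) - pderiv (\<theta> (e i)) * \<theta> (e j)"
    using action unfolding lie_action_def by blast
  then have "\<rho> i (\<rho> j f) - \<rho> j (\<rho> i f) = \<theta> (bracket (e i) (e j)) * pderiv f"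
    by (simp only: \<rho>_def pderiv_mult) (simp add: algebra_simps)
  also have "\<dots> = (\<Sum>k\<in>UNIV. b i j $ k * \<rho> k f)"
    using anchor_poly_T[of "bracket (e i) (e j)"]
    by (simp add: b_def \<rho>_def anchor_poly_def flip: mult.assoc sum_distrib_right)
  finally show "\<rho> i (\<rho> j f) - \<rho> j (\<rho> i f) = (\<Sum>k\<in>UNIV. b i j $ k * \<rho> k f)" .
  have "frame_ad \<rho> b i (ext1 (b j k)) + frame_ad \<rho> b j (ext1 (b k i)) + frame_ad \<rho> b k (ext1 (b i j)) =
      ext1 (T (bracket (e i) (bracket (e j) (e k)) + bracket (e j) (bracket (e k) (e i))
        + bracket (e k) (bracket (e i) (e j))))"
    unfolding b_def frame_ad_ext1_T by (simp only: T_add ext1_linear)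
  then show "frame_ad \<rho> b i (ext1 (b j k)) + frame_ad \<rho> b j (ext1 (b k i))
      + frame_ad \<rho> b k (ext1 (b i j)) = 0"
    using additive_0[of T, OF T_add] by (simp add: lie.jacobi ext1_linear)
qed

lemma map_rho_ext1:
  fixes u :: "('k poly, 'i) vec"
  shows "map_ext (\<rho> i) (ext1 u) = (\<Sum>j\<in>UNIV. \<rho> i (u $ j) *s gen j)"
proof -
  have "map_ext (\<rho> i) (sum F I) = (\<Sum>j\<in>I. map_ext (\<rho> i) (F j))" for F :: "'i \<Rightarrow> ('k poly, 'i) ext" and I
    by (induction I rule: infinite_finite_induct)
      (simp_all add: ext_derivation_0[OF map_rho_derivation] ext_derivation_add[OF map_rho_derivation])
  then show ?thesis
    by (simp add: ext1_alt ext_derivation_scale[OF map_rho_derivation])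
qed

lemma crossed_bracket_schouten: "ext1 (crossed_bracket scl bracket e \<theta> u v) = sch (ext1 u) (ext1 v)"
proof -
  have tensor_basis: "tensor scl e f (e j) = f *s axis j 1"
    and tensor_b: "tensor scl e f (bracket (e i) (e j)) = f *s b i j" for f i j
    by (simp_all add: tensor_eq[of f] T_basis b_def)
  have 1: "ext1 (crossed_bracket scl bracket e \<theta> u v) =
      (\<Sum>i\<in>UNIV. \<Sum>j\<in>UNIV. (u $ i * v $ j) *s ext1 (b i j))
      + (\<Sum>i\<in>UNIV. \<Sum>j\<in>UNIV. (u $ i * \<rho> i (v $ j)) *s gen j)
      - (\<Sum>i\<in>UNIV. \<Sum>j\<in>UNIV. (v $ j * \<rho> j (u $ i)) *s gen i)"
    unfolding crossed_bracket_def
    by (simp add: tensor_basis tensor_b \<rho>_def ext1_sum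
        sum.distrib sum_subtractf ext1_linear gen_eq_ext1)
  \<comment> \<open>In \<open>frame_schouten\<close> the structure term has a minus sign and its
    indices are exchanged; \<open>b_skew\<close> makes up for both.\<close>
  have "(\<Sum>i\<in>UNIV. \<Sum>j\<in>UNIV. (v $ i * u $ j) *s ext1 (b i j)) =
      - (\<Sum>i\<in>UNIV. \<Sum>j\<in>UNIV. (u $ i * v $ j) *s ext1 (b i j))"
    unfolding sum_negf[symmetric]
    by (subst sum.swap, intro sum.cong refl, subst b_skew) (simp add: ext1_linear vec_scale_simps mult.commute)
  moreover have "(\<Sum>i\<in>UNIV. \<Sum>j\<in>UNIV. (v $ j * \<rho> j (u $ i)) *s (gen i :: ('k poly, 'i) ext)) =
      (\<Sum>i\<in>UNIV. \<Sum>j\<in>UNIV. (v $ i * \<rho> i (u $ j)) *s gen j)"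
    by (rule sum.swap)
  ultimately show ?thesis
    unfolding 1
    by (simp add: frame_schouten_def frame_ad_def map_rho_ext1 vec_scale_simps wedge_linear
        sum.distrib sum_subtractf) (simp add: mult.commute)
qed

lemma crossed_anchor_rho: "crossed_anchor e \<theta> u f = (\<Sum>i\<in>UNIV. u $ i * \<rho> i f)"
  by (simp add: crossed_anchor_def anchor_poly_def \<rho>_def sum_distrib_right mult.assoc)

lemma is_schouten_crossed:
  "is_schouten smult (crossed_bracket scl bracket e \<theta>) (crossed_anchor e \<theta>) sch"
  by (rule is_schouten_frame[OF _ crossed_bracket_schouten crossed_anchor_rho]) (simp add: \<rho>_def)

lemma crossed_schouten_eq: "crossed_schouten scl bracket e \<theta> = sch"
  unfolding crossed_schouten_def by (rule schouten_eqI[OF is_schouten_crossed])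

lemma eq_minus_self: "x = - x \<Longrightarrow> x = 0" for x :: "('k poly, 'n::finite) vec"
proof -
  assume "x = - x"
  then have "smult 2 (x $ i) = 0" for i
    by (metis add.right_inverse one_add_one smult_1_left smult_add_left vector_uminus_component)
  then show "x = 0" by (simp add: vec_eq_iff)
qed

lemma crossed_lie_rinehart_algebra:
  "lie_rinehart_algebra smult (*s) (crossed_bracket scl bracket e \<theta>) (crossed_anchor e \<theta>)"
proof (rule is_schouten_lie_rinehart_algebra[OF is_schouten_crossed])
  show "comm_algebra (smult :: 'k \<Rightarrow> 'k poly \<Rightarrow> 'k poly)"
    by standard (simp_all add: smult_add_right smult_add_left)
  fix u
  have "sch (ext1 u) (ext1 u) = - sch (ext1 u) (ext1 u)"
    using sch_skew[OF ext1_parity ext1_parity, of u u] by simp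
  then have "ext1 (crossed_bracket scl bracket e \<theta> u u) = ext1 0"
    unfolding crossed_bracket_schouten ext1_linear by (rule eq_minus_self)
  then show "crossed_bracket scl bracket e \<theta> u u = 0" by simp
qed

abbreviation \<iota> where "\<iota> \<equiv> contract_anchor e \<theta>"

text \<open>Every anchor is a multiple of \<open>d/dt\<close>, so a single operator
  \<open>\<iota>\<close> governs the brackets with all functions, and testing on \<open>t\<close> is
  enough.\<close>

lemma sch_ext0: "sch x (ext0 f) = pderiv f *s grade_involution (\<iota> x)"
  by (simp add: sch_ext0_right contract_anchor_def \<rho>_def grade_involution_scale
      grade_involution_sum vec_scale_simps mult.commute)

lemma sch_kernel_wedge_ext0: "\<nu> \<in> kernel_wedge e \<theta> \<Longrightarrow> sch \<nu> (ext0 f) = 0"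
  using kernel_wedge_D(2) by (metis sch_ext0 grade_involution_0 vec_scale_zero_right)

subsection \<open>Compatible pairs and bialgebras\<close>

lemma ext_g_basis: "ext_g scl e (e i) = gen i"
  by (simp add: ext_g_def T_basis gen_eq_ext1)

lemma ext_g_grade: "ext_g scl e X \<in> ext_grade (Suc 0)"
  by (simp add: ext_g_def ext1_grade)

lemma ext_g_add: "ext_g scl e (X + Y) = ext_g scl e X + ext_g scl e Y"
  and ext_g_scale: "ext_g scl e (scl c X) = [:c:] *s ext_g scl e X"
  by (simp_all add: ext_g_def T_add T_scale ext1_linear)

lemma sch_ext_g: "sch (ext_g scl e X) (ext_g scl e Y) = ext_g scl e (bracket X Y)"
  unfolding ext_g_def crossed_bracket_schouten[symmetric] crossed_bracket_tensor[OF lie basis action]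
  by (simp add: tensor_def zero_vec_def[symmetric])

lemma sch_0_right: "sch x 0 = 0"
  using sch_add_right by (rule additive_0)

lemma sch_diff_left: "sch (x - y) z = sch x z - sch y z"
  using sch_add_left[of "x - y" y z] by simp

lemma sch_diff_right: "sch x (y - z) = sch x y - sch x z"
  using sch_add_right[of x "y - z" z] by simp

lemma sch_scale_left: "sch ([:c:] *s x) y = [:c:] *s sch x y"
  and sch_scale_right: "sch x ([:c:] *s y) = [:c:] *s sch x y"
  using is_schouten_scale[OF is_schouten_crossed, where c = c] by simp_all

lemma sch_anchor_ext0_1: "sch x (ext0 [:0, 1:]) = grade_involution (\<iota> x)"
  by (simp add: sch_ext0 pderiv_pCons flip: one_pCons)

text \<open>If \<open>p\<close> is the projection to the kernel along \<open>x0\<close>, then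
  \<open>(p \<and> p) \<nu> = \<nu> - x0 \<and> \<iota> \<nu>\<close>.\<close>

lemma kernel_wedge_iff:
  assumes x0: "anchor_poly e \<theta> x0 = 1"
  shows "\<nu> \<in> kernel_wedge e \<theta> \<longleftrightarrow> \<nu> \<in> ext_grade 2 \<and> \<iota> \<nu> = 0"
proof
  assume \<nu>: "\<nu> \<in> ext_grade 2 \<and> \<iota> \<nu> = 0"
  interpret M: module "(*s) :: 'k poly \<Rightarrow> ('k poly, 'i) ext \<Rightarrow> _" by (rule module_vec)
  define p where "p i = axis i 1 - \<theta> (e i) *s x0" for i
  have anchor_axis: "anchor_poly e \<theta> (axis i 1) = \<theta> (e i)" for i
    using anchor_poly_T[of "e i"] by (simp add: T_basis)
  have "anchor_poly e \<theta> (u - f *s v) = anchor_poly e \<theta> u - f * anchor_poly e \<theta> v" for u v f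
    by (simp add: anchor_poly_def sum_distrib_left sum_subtractf algebra_simps)
  then have p_kernel: "p i \<in> anchor_kernel e \<theta>" for i
    by (simp add: p_def anchor_kernel_def anchor_axis x0)
  have ext1_p: "ext1 (p i) = gen i - \<theta> (e i) *s ext1 x0" for i
    by (simp add: p_def ext1_linear gen_eq_ext1)
  have x0x0: "ext1 x0 \<^bold>\<and> ext1 x0 = 0"
    using wedge_commute[OF ext1_parity ext1_parity, of x0 x0] by (intro eq_minus_self) simp
  have pp: "ext1 (p i) \<^bold>\<and> ext1 (p j) =
      gen i \<^bold>\<and> gen j - ext1 x0 \<^bold>\<and> \<iota> (gen i \<^bold>\<and> gen j)" for i j
    using wedge_commute[OF gen_parity ext1_parity, of i x0]
    by (simp add: gen_eq_ext1 contract_anchor_wedge anchor_axis ext1_p[unfolded gen_eq_ext1])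
      (simp add: wedge_linear x0x0 vec_scale_simps)
  have "axis S (\<nu> $ S) - ext1 x0 \<^bold>\<and> \<iota> (axis S (\<nu> $ S)) \<in> kernel_wedge e \<theta>" for S
  proof (cases "\<nu> $ S = 0")
    case True
    then have zero: "axis S (\<nu> $ S) = 0" by simp
    show ?thesis unfolding zero by (simp add: contract_anchor_0 kernel_wedge_def M.span_zero)
  next
    case False
    then have "card S = 2" using \<nu> by (auto simp: ext_grade_def)
    then obtain i j where S: "S = {i, j}" "i \<noteq> j" by (auto simp: card_2_iff)
    \<comment> \<open>The enumeration \<open>S = {i, j}\<close> need not be increasing;
      \<open>s\<close> is the sign that corrects this and is its own inverse.\<close>
    define s :: "'k poly" where "s = shuffle_sign {i} {j}"
    have ss: "s * s = 1" by (simp add: s_def)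
    have "axis S (\<nu> $ S) = (\<nu> $ S * s) *s (gen i \<^bold>\<and> gen j)"
      using S ss by (simp add: wedge_axis vec_eq_iff axis_nth insert_commute mult.assoc flip: s_def)
    then have *: "axis S (\<nu> $ S) - ext1 x0 \<^bold>\<and> \<iota> (axis S (\<nu> $ S)) =
        (\<nu> $ S * s) *s (ext1 (p i) \<^bold>\<and> ext1 (p j))"
      by (simp add: pp contract_anchor_scale wedge_linear vec_scale_simps)
    show ?thesis
      unfolding * kernel_wedge_def using p_kernel by (intro M.span_scale M.span_base) blast
  qed
  then have sum: "(\<Sum>S\<in>UNIV. axis S (\<nu> $ S) - ext1 x0 \<^bold>\<and> \<iota> (axis S (\<nu> $ S))) \<in> kernel_wedge e \<theta>"
    unfolding kernel_wedge_def by (intro M.span_sum) auto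
  have \<iota>_sum: "\<iota> (sum F I) = (\<Sum>S\<in>I. \<iota> (F S))" for F :: "'i set \<Rightarrow> ('k poly, 'i) ext" and I
    by (induction I rule: infinite_finite_induct) (simp_all add: contract_anchor_0 contract_anchor_add)
  have \<nu>_sum: "(\<Sum>S\<in>UNIV. axis S (\<nu> $ S)) = \<nu>" by (simp add: vec_eq_iff axis_def)
  have "(\<Sum>S\<in>UNIV. \<iota> (axis S (\<nu> $ S))) = 0"
    using \<iota>_sum[of "\<lambda>S. axis S (\<nu> $ S)" UNIV] \<nu> \<nu>_sum by simp
  then show "\<nu> \<in> kernel_wedge e \<theta>"
    using sum \<nu>_sum by (simp add: sum_subtractf flip: wedge_sum_right)
qed (use kernel_wedge_D in blast)

lemma extend_derivation:
  assumes "\<And>i. \<Omega> (e i) \<in> ext_parity 0"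
  shows "ext_derivation (Suc 0) (extend e \<Omega>)"
proof -
  have "ext_derivation (Suc 0) (\<lambda>x. \<Sum>i\<in>UNIV. \<Omega> (e i) \<^bold>\<and> contract i x)"
    using ext_derivation_wedge_left[OF ext_derivation_contract assms]
    by (intro ext_derivation_sum) simp
  moreover have "extend e \<Omega> = (\<lambda>x. \<Sum>i\<in>UNIV. \<Omega> (e i) \<^bold>\<and> contract i x)"
    by (rule ext) (rule extend_eq[of \<Omega> e, OF assms])
  ultimately show ?thesis by simp
qed

lemma extend_ext0: "(\<And>i. \<Omega> (e i) \<in> ext_parity 0) \<Longrightarrow> extend e \<Omega> (ext0 f) = 0"
  by (simp add: extend_eq)

lemma extend_gen: "(\<And>i. \<Omega> (e i) \<in> ext_parity 0) \<Longrightarrow> extend e \<Omega> (gen i) = \<Omega> (e i)"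
  by (simp add: extend_eq if_distrib[of "\<lambda>x. _ \<^bold>\<and> x"] cong: if_cong)

lemma extend_ext_g:
  assumes "\<And>i. \<Omega> (e i) \<in> ext_parity 0" and "Vector_Spaces.linear scl (\<lambda>c. (*s) [:c:]) \<Omega>"
  shows "extend e \<Omega> (ext_g scl e X) = \<Omega> X"
proof -
  interpret \<Omega>: Vector_Spaces.linear scl "\<lambda>c. (*s) [:c:]" \<Omega> by fact
  have "\<Omega> X = (\<Sum>i\<in>UNIV. [:coord X i:] *s \<Omega> (e i))"
    by (subst (1) expand[of X, symmetric]) (simp only: \<Omega>.sum \<Omega>.scale)
  then show ?thesis by (simp add: extend_eq[of \<Omega> e, OF assms(1)] ext_g_def T_nth)
qed

definition pair_differential where "pair_differential \<Lambda> \<Omega> x = sch \<Lambda> x + extend e \<Omega> x"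

text \<open>By the Jacobi identity \<open>[\<Lambda>, [\<Lambda>, x]]\<close> is half of
  \<open>[[\<Lambda>, \<Lambda>], x]\<close>, and by \<open>E_sch\<close> the mixed terms add up to
  \<open>[E \<Lambda>, x]\<close>. The operator \<open>E\<close> is kept abstract because it is an
  extension \<open>extend e \<Omega>\<close> in one direction of the correspondence and a difference
  of differentials in the other.\<close>

lemma pair_differential_square:
  assumes \<Lambda>: "\<Lambda> \<in> ext_parity 0" and E: "ext_derivation (Suc 0) E"
    and E_sch: "\<And>x. E (sch \<Lambda> x) = sch (E \<Lambda>) x - sch \<Lambda> (E x)"
  shows "sch \<Lambda> (sch \<Lambda> x + E x) + E (sch \<Lambda> x + E x) =
    sch ([:1 / 2:] *s sch \<Lambda> \<Lambda> + E \<Lambda>) x + E (E x)"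
proof -
  have "sch (sch \<Lambda> \<Lambda>) x = sch \<Lambda> (sch \<Lambda> x) + sch \<Lambda> (sch \<Lambda> x)"
    using sch_jacobi[OF \<Lambda> \<Lambda>, of x] by (simp add: vec_scale_simps eq_diff_eq)
  moreover have "[:1 / 2:] *s (y + y) = y" for y :: "('k poly, 'i) ext"
  proof -
    have "[:1 / 2:] *s (y + y) = ([:1 / 2:] + [:1 / 2:]) *s y" by (simp only: vec_scale_simps)
    also have "[:1 / 2:] + [:1 / 2:] = (1 :: 'k poly)" by (simp add: one_pCons)
    finally show ?thesis by simp
  qed
  ultimately have "sch ([:1 / 2:] *s sch \<Lambda> \<Lambda>) x = sch \<Lambda> (sch \<Lambda> x)"
    by (simp only: sch_scale_left)
  then show ?thesis
    by (simp add: sch_add_left sch_add_right ext_derivation_add[OF E] E_sch)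
qed

context
  fixes \<Lambda> :: "('k poly, 'i) ext" and \<Omega> :: "'g \<Rightarrow> ('k poly, 'i) ext"
  assumes pair: "(\<Lambda>, \<Omega>) \<in> compatible_pairs scl bracket e \<theta>"
begin

lemma pair_grade: "\<Lambda> \<in> ext_grade 2"
  and pair_linear: "Vector_Spaces.linear scl (\<lambda>c. (*s) [:c:]) \<Omega>"
  and pair_kernel: "\<Omega> X \<in> kernel_wedge e \<theta>"
  and pair_cocycle: "\<Omega> (bracket X Y) = sch (\<Omega> X) (ext_g scl e Y) + sch (ext_g scl e X) (\<Omega> Y)"
  and pair_square: "sch ([:1 / 2:] *s sch \<Lambda> \<Lambda> + extend e \<Omega> \<Lambda>) (ext1 u)
    + extend e \<Omega> (extend e \<Omega> (ext1 u)) = 0"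
  using pair unfolding compatible_pairs_def cocycle_def crossed_schouten_eq by auto

lemma pair_even: "\<Omega> (e i) \<in> ext_parity 0"
  by (rule ext_grade_2_parity[OF kernel_wedge_D(1)[OF pair_kernel]])

lemma pair_derivation: "ext_derivation (Suc 0) (pair_differential \<Lambda> \<Omega>)"
  unfolding pair_differential_def[abs_def]
  by (intro ext_derivation_plus sch_derivation ext_grade_2_parity pair_grade
      extend_derivation[of \<Omega>, OF pair_even])

text \<open>Checked on generators: for two functions everything vanishes, for a basis vector and a
  function the point is that elements of \<open>kernel_wedge\<close> commute with functions, and for
  two basis vectors it is the cocycle identity.\<close>

lemma extend_schouten:
  assumes "x \<in> ext_parity k"
  shows "extend e \<Omega> (sch x y) =
    sch (extend e \<Omega> x) y + (- 1) ^ (Suc 0 * (k + 1)) *s sch x (extend e \<Omega> y)"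
proof (rule derivation_schouten[OF extend_derivation[of \<Omega>, OF pair_even] _ _ _ assms])
  have 0: "sch 0 x = 0" for x using additive_0[of "\<lambda>z. sch z x"] sch_add_left by simp
  fix f g i j
  show "extend e \<Omega> (sch (ext0 f) (ext0 g)) = sch (extend e \<Omega> (ext0 f)) (ext0 g)
      + (- 1) ^ Suc 0 *s sch (ext0 f) (extend e \<Omega> (ext0 g))"
    using extend_ext0[of \<Omega> 0, OF pair_even] by (simp add: extend_ext0[of \<Omega>, OF pair_even] sch_0_right 0)
  show "extend e \<Omega> (sch (gen i) (ext0 f)) =
      sch (extend e \<Omega> (gen i)) (ext0 f) + sch (gen i) (extend e \<Omega> (ext0 f))"
    using sch_kernel_wedge_ext0[OF pair_kernel]
    by (simp add: extend_ext0[of \<Omega>, OF pair_even] extend_gen[of \<Omega>, OF pair_even] sch_0_right sch_gen ad_ext0)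
  show "extend e \<Omega> (sch (gen i) (gen j)) =
      sch (extend e \<Omega> (gen i)) (gen j) + sch (gen i) (extend e \<Omega> (gen j))"
    using pair_cocycle[of "e i" "e j"]
    by (simp add: extend_gen[of \<Omega>, OF pair_even] flip: ext_g_basis)
      (simp add: sch_ext_g extend_ext_g[of \<Omega>, OF pair_even pair_linear])
qed

lemma pair_differential_pair_differential:
  "pair_differential \<Lambda> \<Omega> (pair_differential \<Lambda> \<Omega> x) =
    sch ([:1 / 2:] *s sch \<Lambda> \<Lambda> + extend e \<Omega> \<Lambda>) x + extend e \<Omega> (extend e \<Omega> x)"
  unfolding pair_differential_def
  by (rule pair_differential_square[OF ext_grade_2_parity[OF pair_grade] extend_derivation[of \<Omega>, OF pair_even]])
    (simp add: extend_schouten[OF ext_grade_2_parity[OF pair_grade]] vec_scale_simps)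

lemma extend_grade: "x \<in> ext_grade k \<Longrightarrow> extend e \<Omega> x \<in> ext_grade (k + 1)"
proof -
  assume x: "x \<in> ext_grade k"
  have "\<Omega> (e i) \<^bold>\<and> contract i x \<in> ext_grade (k + 1)" for i
  proof (cases k)
    case 0
    then show ?thesis using x by (simp add: contract_grade_0)
  next
    case (Suc l)
    then show ?thesis
      using ext_grade_wedge[OF kernel_wedge_D(1)[OF pair_kernel[of "e i"]] contract_grade[of x l i]] x
      by simp
  qed
  then show ?thesis by (simp add: extend_eq[of \<Omega> e, OF pair_even] ext_grade_sum)
qed

lemma pair_differential_grade: "x \<in> ext_grade k \<Longrightarrow> pair_differential \<Lambda> \<Omega> x \<in> ext_grade (k + 1)"
  unfolding pair_differential_def
  using extend_grade sch_grade[OF pair_grade, of x k] by (auto intro: ext_grade_add)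

lemma compatible_crossed_bialgebra:
  assumes "3 \<le> card (UNIV :: 'i set)"
  shows "crossed_bialgebra scl bracket e \<theta> (pair_differential \<Lambda> \<Omega>)"
proof -
  have square: "pair_differential \<Lambda> \<Omega> (pair_differential \<Lambda> \<Omega> x) = 0" for x
  proof (rule ext_derivation_eq_0[OF ext_derivation_square[OF pair_derivation]])
    show gen: "pair_differential \<Lambda> \<Omega> (pair_differential \<Lambda> \<Omega> (gen i)) = 0" for i
      using pair_square by (simp add: pair_differential_pair_differential gen_eq_ext1)
    fix f
    let ?w = "pair_differential \<Lambda> \<Omega> (pair_differential \<Lambda> \<Omega> (ext0 f))"
    show "?w = 0"
    proof (rule wedge_gen_eq_0[OF _ _ assms])
      show "?w \<in> ext_grade 2"
        using pair_differential_grade[OF pair_differential_grade[OF ext0_grade]] by (simp add: numeral_2_eq_2)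
      fix i :: 'i
      \<comment> \<open>The square condition holds at \<open>f *s gen i\<close> as well as at
        \<open>gen i\<close>; comparing the two by the Leibniz rule isolates
        \<open>?w \<and> gen i\<close>.\<close>
      have "f *s gen i = ext1 (f *s axis i 1)"
        by (simp add: gen_eq_ext1 ext1_linear)
      then have "pair_differential \<Lambda> \<Omega> (pair_differential \<Lambda> \<Omega> (f *s gen i)) = 0"
        using pair_square by (simp add: pair_differential_pair_differential)
      then show "?w \<^bold>\<and> gen i = 0"
        using ext_derivation_scale[OF ext_derivation_square[OF pair_derivation], of f "gen i"] gen
        by simp
    qed
  qed
  have schouten: "pair_differential \<Lambda> \<Omega> (sch x y) =
      sch (pair_differential \<Lambda> \<Omega> x) y + (- 1) ^ (k + 1) *s sch x (pair_differential \<Lambda> \<Omega> y)" if "x \<in> ext_grade k" for k x y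
    using sch_jacobi[OF ext_grade_2_parity[OF pair_grade] ext_grade_parity[OF that], of y]
      extend_schouten[OF ext_grade_parity[OF that], of y]
    by (simp add: pair_differential_def sch_add_left sch_add_right vec_scale_simps)
  have scale: "pair_differential \<Lambda> \<Omega> ([:c:] *s x) = [:c:] *s pair_differential \<Lambda> \<Omega> x" for c x
    by (simp add: pair_differential_def sch_scale_right extend_eq[of \<Omega> e, OF pair_even] contract_scale wedge_linear
        vec_scale_simps)
  have "vector_space (\<lambda>c. (*s) [:c:] :: ('k poly, 'i) ext \<Rightarrow> _)"
    by standard (simp_all add: vec_scale_simps mult.commute flip: one_pCons vec_scale_simps(3))
  then have "Vector_Spaces.linear (\<lambda>c. (*s) [:c:]) (\<lambda>c. (*s) [:c:]) (pair_differential \<Lambda> \<Omega>)"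
    by (simp add: Vector_Spaces.linear_iff scale ext_derivation_add[OF pair_derivation])
  then show ?thesis
    unfolding crossed_bialgebra_def lie_rinehart_bialgebra_def Let_def
      schouten_eqI[OF is_schouten_crossed]
    using crossed_lie_rinehart_algebra pair_differential_grade square schouten
      ext_derivation_wedge[OF pair_derivation ext_grade_parity]
    by simp
qed

end

lemma pair_equiv_iff:
  assumes x0: "anchor_poly e \<theta> x0 = 1"
    and 1: "(\<Lambda>, \<Omega>) \<in> compatible_pairs scl bracket e \<theta>"
    and 2: "(\<Lambda>', \<Omega>') \<in> compatible_pairs scl bracket e \<theta>"
  shows "((\<Lambda>, \<Omega>), (\<Lambda>', \<Omega>')) \<in> pair_equiv scl bracket e \<theta> \<longleftrightarrow> pair_differential \<Lambda> \<Omega> = pair_differential \<Lambda>' \<Omega>'"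
proof
  assume "((\<Lambda>, \<Omega>), (\<Lambda>', \<Omega>')) \<in> pair_equiv scl bracket e \<theta>"
  then obtain \<nu> where \<nu>: "\<nu> \<in> kernel_wedge e \<theta>" "\<Lambda>' = \<Lambda> + \<nu>"
    "\<And>X. \<Omega>' X = \<Omega> X - sch \<nu> (ext_g scl e X)"
    unfolding pair_equiv_def crossed_schouten_eq by auto
  have "pair_differential \<Lambda> \<Omega> x = pair_differential \<Lambda>' \<Omega>' x" for x
    \<comment> \<open>On functions \<open>\<nu>\<close> contributes nothing, and on basis vectors
      its bracket cancels the change of \<open>\<Omega>\<close>.\<close>
    by (rule ext_derivation_eqI[OF pair_derivation[OF 1] pair_derivation[OF 2]])
      (simp_all add: pair_differential_def extend_ext0[of \<Omega>, OF pair_even[OF 1]] extend_ext0[of \<Omega>', OF pair_even[OF 2]]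
        extend_gen[of \<Omega>, OF pair_even[OF 1]] extend_gen[of \<Omega>', OF pair_even[OF 2]]
        \<nu>(2,3) sch_add_left sch_kernel_wedge_ext0[OF \<nu>(1)] ext_g_basis)
  then show "pair_differential \<Lambda> \<Omega> = pair_differential \<Lambda>' \<Omega>'" by (rule ext)
next
  assume eq: "pair_differential \<Lambda> \<Omega> = pair_differential \<Lambda>' \<Omega>'"
  define \<nu> where "\<nu> = \<Lambda>' - \<Lambda>"
  have \<Lambda>': "\<Lambda>' = \<Lambda> + \<nu>" by (simp add: \<nu>_def)
  have eq_at: "sch \<Lambda> x + extend e \<Omega> x = sch \<Lambda> x + sch \<nu> x + extend e \<Omega>' x" for x
    using fun_cong[OF eq, of x] by (simp add: pair_differential_def \<Lambda>' sch_add_left)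
  have "\<nu> \<in> ext_grade 2"
    using pair_grade[OF 1] pair_grade[OF 2] by (simp add: \<nu>_def ext_grade_diff)
  \<comment> \<open>Both extensions kill functions, so evaluation at \<open>t\<close> leaves only
    the bracket of \<open>\<nu>\<close> with \<open>t\<close>.\<close>
  moreover have "\<iota> \<nu> = 0"
    using eq_at[of "ext0 [:0, 1:]"]
    by (simp add: extend_ext0[of \<Omega>, OF pair_even[OF 1]] extend_ext0[of \<Omega>', OF pair_even[OF 2]]
        sch_anchor_ext0_1)
  ultimately have "\<nu> \<in> kernel_wedge e \<theta>" by (simp add: kernel_wedge_iff[OF x0])
  moreover have "\<Omega>' X = \<Omega> X - sch \<nu> (ext_g scl e X)" for X
    using eq_at[of "ext_g scl e X"]
    by (simp add: extend_ext_g[of \<Omega>, OF pair_even[OF 1] pair_linear[OF 1]]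
        extend_ext_g[of \<Omega>', OF pair_even[OF 2] pair_linear[OF 2]])
  ultimately show "((\<Lambda>, \<Omega>), (\<Lambda>', \<Omega>')) \<in> pair_equiv scl bracket e \<theta>"
    using 1 2 \<Lambda>' unfolding pair_equiv_def crossed_schouten_eq by blast
qed

lemma crossed_bialgebra_compatible:
  assumes x0: "anchor_poly e \<theta> x0 = 1" and \<sigma>: "crossed_bialgebra scl bracket e \<theta> \<sigma>"
  shows "\<exists>\<Lambda> \<Omega>. (\<Lambda>, \<Omega>) \<in> compatible_pairs scl bracket e \<theta> \<and> \<sigma> = pair_differential \<Lambda> \<Omega>"
proof -
  have linear: "Vector_Spaces.linear (\<lambda>c. (*s) [:c:]) (\<lambda>c. (*s) [:c:]) \<sigma>"
    and grade: "x \<in> ext_grade k \<Longrightarrow> \<sigma> x \<in> ext_grade (k + 1)"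
    and wedge: "x \<in> ext_grade k \<Longrightarrow> \<sigma> (x \<^bold>\<and> y) = \<sigma> x \<^bold>\<and> y + (- 1) ^ k *s (x \<^bold>\<and> \<sigma> y)"
    and square: "\<sigma> (\<sigma> x) = 0"
    and schouten: "x \<in> ext_grade k \<Longrightarrow>
      \<sigma> (sch x y) = sch (\<sigma> x) y + (- 1) ^ (k + 1) *s sch x (\<sigma> y)" for k x y
    using \<sigma> unfolding crossed_bialgebra_def lie_rinehart_bialgebra_def Let_def
      schouten_eqI[OF is_schouten_crossed] by (simp_all add: algebra_simps)
  interpret \<sigma>: Vector_Spaces.linear "\<lambda>c. (*s) [:c:]" "\<lambda>c. (*s) [:c:]" \<sigma> by (rule linear)
  have derivation: "ext_derivation (Suc 0) \<sigma>"
    using grade ext_grade_parity by (intro ext_derivation_gradeI) (fastforce simp: \<sigma>.add wedge)+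
  have "\<sigma> (ext0 1) = 0"
    using ext_derivation_scale[OF derivation, of 1 "ext0 1"] by simp
  then have \<sigma>_const: "\<sigma> (ext0 [:c:]) = 0" for c
    using \<sigma>.scale[of c "ext0 1"] by (simp add: ext0_scale)
  note \<sigma>_ext0 = ext_derivation_ext0_poly[OF derivation \<sigma>_const]
  let ?t = "ext0 [:0, 1:] :: ('k poly, 'i) ext"
  obtain a where a: "\<sigma> ?t = ext1 a"
    using ext_grade_1_ext1 grade[OF ext0_grade] by fastforce
  have sch_t: "sch (ext1 u) ?t = ext0 (anchor_poly e \<theta> u)" for u
    using is_schouten_anchor[OF is_schouten_crossed, of u "[:0, 1:]"]
    by (simp add: crossed_anchor_def pderiv_pCons)
  \<comment> \<open>Applied to \<open>[t, t] = 0\<close>, \<open>\<sigma>\<close> gives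
    \<open>[a, t] - [t, a]\<close>. Since \<open>[t, a] = - [a, t]\<close>, the terms add up instead
    of cancelling.\<close>
  have "ext0 (anchor_poly e \<theta> a) = - (ext0 (anchor_poly e \<theta> a) :: ('k poly, 'i) ext)"
    using schouten[OF ext0_grade, of "[:0, 1:]" ?t] sch_skew[OF ext0_parity ext1_parity, of "[:0, 1:]" a]
    by (simp add: a sch_t vec_scale_simps \<sigma>.zero eq_neg_iff_add_eq_0)
  then have anchor_a: "anchor_poly e \<theta> a = 0"
    using eq_minus_self ext0_eq_iff ext0_0 by metis
  \<comment> \<open>As \<open>a\<close> has anchor 0 and \<open>x0\<close> has anchor 1, contracting
    this bivector gives \<open>- a\<close>; the grade involution removes the sign, so its bracket
    with \<open>t\<close> is \<open>a\<close>, the value of \<open>\<sigma>\<close> there.\<close>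
  define \<Lambda> where "\<Lambda> = ext1 a \<^bold>\<and> ext1 x0"
  have \<Lambda>: "\<Lambda> \<in> ext_grade 2"
    using ext_grade_wedge[OF ext1_grade ext1_grade, of a x0] by (simp add: \<Lambda>_def numeral_2_eq_2)
  note \<Lambda>_even = ext_grade_2_parity[OF \<Lambda>]
  have "\<iota> \<Lambda> = - ext1 a"
    by (simp add: \<Lambda>_def contract_anchor_wedge anchor_a x0)
  then have sch_\<Lambda>: "sch \<Lambda> (ext0 f) = pderiv f *s ext1 a" for f
    using grade_involution_parity[OF ext_parity_minus[OF ext1_parity], of a]
    by (simp add: sch_ext0 vec_scale_simps)
  \<comment> \<open>Bracketing with \<open>\<Lambda>\<close> accounts for all that
    \<open>\<sigma>\<close> does to functions. The remainder is \<open>K[t]\<close>-linear and hence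
    determined by its values on the Lie algebra.\<close>
  define E where "E x = \<sigma> x - sch \<Lambda> x" for x
  have E: "ext_derivation (Suc 0) E"
    unfolding E_def[abs_def] by (intro ext_derivation_subtract derivation sch_derivation \<Lambda>_even)
  have E_ext0: "E (ext0 f) = 0" for f
    by (simp add: E_def \<sigma>_ext0[of f] a sch_\<Lambda>)
  have E_schouten: "E (sch x y) = sch (E x) y + (- 1) ^ (k + 1) *s sch x (E y)"
    if x: "x \<in> ext_grade k" for x y k
    using schouten[OF x, of y] sch_jacobi[OF \<Lambda>_even ext_grade_parity[OF x], of y]
    by (simp add: E_def sch_diff_left sch_diff_right vec_scale_simps)
  have E_grade: "E x \<in> ext_grade 2" if "x \<in> ext_grade (Suc 0)" for x
    using grade[OF that] sch_grade[OF \<Lambda> that] by (simp add: E_def ext_grade_diff numeral_2_eq_2)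
  define \<Omega> where "\<Omega> X = E (ext_g scl e X)" for X
  have kernel: "\<Omega> X \<in> kernel_wedge e \<theta>" for X
  proof -
    \<comment> \<open>The bracket of \<open>X\<close> with \<open>t\<close> is again a function, so
      \<open>E\<close> kills both it and \<open>t\<close>; the Leibniz rule leaves this term
      alone.\<close>
    have "sch (\<Omega> X) ?t = 0"
      using E_schouten[OF ext_g_grade, of X ?t] sch_t
      by (simp add: E_ext0 sch_0_right \<Omega>_def) (simp add: ext_g_def E_ext0)
    then have "\<iota> (\<Omega> X) = 0" by (simp add: sch_anchor_ext0_1)
    then show ?thesis by (simp add: kernel_wedge_iff[OF x0] \<Omega>_def E_grade ext_g_grade)
  qed
  note even = ext_grade_2_parity[OF kernel_wedge_D(1)[OF kernel]]
  have extend: "extend e \<Omega> x = E x" for x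
    by (rule ext_derivation_eqI[OF extend_derivation[of \<Omega>, OF even] E])
      (simp_all add: extend_ext0[of \<Omega>, OF even] extend_gen[of \<Omega>, OF even] E_ext0 \<Omega>_def ext_g_basis)
  have \<sigma>_eq: "\<sigma> x = sch \<Lambda> x + E x" for x by (simp add: E_def)
  have "vector_space (\<lambda>c. (*s) [:c:] :: ('k poly, 'i) ext \<Rightarrow> _)" by (rule \<sigma>.vs1.vector_space_axioms)
  moreover have "E ([:c:] *s x) = [:c:] *s E x" for c x
    by (simp add: E_def \<sigma>.scale sch_scale_right vec_scale_simps)
  ultimately have "Vector_Spaces.linear scl (\<lambda>c. (*s) [:c:]) \<Omega>"
    by (simp add: Vector_Spaces.linear_iff lie.vector_space_axioms \<Omega>_def ext_g_add ext_g_scale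
        ext_derivation_add[OF E])
  moreover have "\<Omega> (bracket X Y) = sch (\<Omega> X) (ext_g scl e Y) + sch (ext_g scl e X) (\<Omega> Y)" for X Y
    using E_schouten[OF ext_g_grade, of X "ext_g scl e Y"] by (simp add: sch_ext_g \<Omega>_def)
  moreover have "sch ([:1 / 2:] *s sch \<Lambda> \<Lambda> + E \<Lambda>) x + E (E x) = 0" for x
  proof -
    have "E (sch \<Lambda> x) = sch (E \<Lambda>) x - sch \<Lambda> (E x)" for x
      using E_schouten[OF \<Lambda>, of x] by (simp add: vec_scale_simps)
    \<comment> \<open>With \<open>\<sigma>\<close> written as the bracket with
      \<open>\<Lambda>\<close> plus \<open>E\<close>, the left-hand side is
      \<open>\<sigma> (\<sigma> x)\<close>.\<close>
    from pair_differential_square[OF \<Lambda>_even E this, of x] show ?thesis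
      using square[of x] by (simp add: \<sigma>_eq)
  qed
  ultimately have "(\<Lambda>, \<Omega>) \<in> compatible_pairs scl bracket e \<theta>"
    using \<Lambda> kernel
    by (auto simp: compatible_pairs_def cocycle_def crossed_schouten_eq extend)
  moreover have "\<sigma> = pair_differential \<Lambda> \<Omega>"
    by (rule ext) (simp add: pair_differential_def extend \<sigma>_eq)
  ultimately show ?thesis by blast
qed

end

subsection \<open>Actions of Type 3\<close>

lemma vector_space_smult: "vector_space (smult :: 'k::field \<Rightarrow> 'k poly \<Rightarrow> 'k poly)"
  by standard (simp_all add: smult_add_right smult_add_left)

text \<open>One polynomial chosen for each occurring degree gives a basis: distinct degrees force
  independence, and subtracting multiples to cancel leading terms shows that they span. In infinite
  dimension both sides are 0 by convention.\<close>

lemma poly_dim_eq_card_degrees: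
  fixes V :: "'k::field poly set"
  assumes V: "module.subspace smult V"
  shows "vector_space.dim smult V = card (degree ` (V - {0}))"
proof -
  interpret P: vector_space "smult :: 'k \<Rightarrow> 'k poly \<Rightarrow> 'k poly" by (rule vector_space_smult)
  define D where "D = degree ` (V - {0})"
  define f where "f = inv_into (V - {0}) degree"
  have f: "f d \<in> V" "f d \<noteq> 0" "degree (f d) = d" if "d \<in> D" for d
    using that inv_into_into[of d degree "V - {0}"] f_inv_into_f[of d degree "V - {0}"]
    by (auto simp: D_def f_def)
  have "P.independent (f ` D)"
    unfolding P.dependent_explicit
  proof (safe, rule ccontr)
    fix t u v
    assume t: "finite t" "t \<subseteq> f ` D" and sum: "(\<Sum>v\<in>t. smult (u v) v) = 0" and v: "v \<in> t" "u v \<noteq> 0"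
    \<comment> \<open>Among the terms that really occur, the one of highest degree is unique, since
      members of \<open>t\<close> are determined by their degrees. The coefficient of the relation
      at that degree comes from this term alone.\<close>
    define t' where "t' = {v \<in> t. u v \<noteq> 0}"
    have "finite (degree ` t')" "degree ` t' \<noteq> {}" using t v by (auto simp: t'_def)
    then have "Max (degree ` t') \<in> degree ` t'" by (rule Max_in)
    then obtain w where w: "w \<in> t'" "degree w = Max (degree ` t')" by auto
    have le: "degree v \<le> degree w" if "v \<in> t'" for v
      using that \<open>finite (degree ` t')\<close> by (simp add: w(2))
    have inj: "v = w" if "v \<in> t" "degree v = degree w" for v
    proof -
      have "f (degree x) = x" if "x \<in> t" for x using that t(2) f(3) by auto
      then show ?thesis using that w(1) by (metis (no_types, lifting) mem_Collect_eq t'_def)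
    qed
    have zero: "u v * coeff v (degree w) = 0" if "v \<in> t - {w}" for v
    proof (cases "u v = 0")
      case False
      then have "degree v < degree w" using that le inj by (fastforce simp: t'_def)
      then show ?thesis by (simp add: coeff_eq_0)
    qed simp
    have "0 = coeff (\<Sum>v\<in>t. smult (u v) v) (degree w)" by (simp add: sum)
    also have "\<dots> = (\<Sum>v\<in>t. u v * coeff v (degree w))" by (simp add: coeff_sum)
    also have "\<dots> = u w * lead_coeff w"
    proof -
      have "(\<Sum>v\<in>t - {w}. u v * coeff v (degree w)) = 0" by (rule sum.neutral) (use zero in blast)
      then show ?thesis using w(1) t(1) sum.remove[of t w "\<lambda>v. u v * coeff v (degree w)"]
        by (simp add: t'_def)
    qed
    finally have "w = 0" using w(1) by (simp add: t'_def)
    then show False using w(1) t(2) f(2) by (auto simp: t'_def)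
  qed
  moreover have "p \<in> P.span (f ` D)" if "p \<in> V" for p
    using that
  proof (induction "degree p" arbitrary: p rule: less_induct)
    case less
    show ?case
    proof (cases "p = 0")
      case True
      then show ?thesis by (simp add: P.span_zero)
    next
      case False
      define d where "d = degree p"
      have d: "d \<in> D" using False less.prems by (auto simp: D_def d_def)
      have lead: "coeff (f d) d \<noteq> 0" using f(2,3)[OF d] by (metis leading_coeff_0_iff)
      define r where "r = smult (coeff p d / coeff (f d) d) (f d)"
      have "coeff (p - r) d = 0"
        by (simp add: r_def lead)
      moreover have "degree (p - r) \<le> d"
        using degree_smult_le[of _ "f d"] f(3)[OF d]
        by (intro degree_diff_le) (simp_all add: r_def d_def[symmetric])
      ultimately have "p - r = 0 \<or> degree (p - r) < d" by (rule eq_zero_or_degree_less[rotated])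
      moreover have "p - r \<in> V"
        using P.subspace_diff[OF V less.prems P.subspace_scale[OF V f(1)[OF d]]] by (simp add: r_def)
      ultimately have "p - r \<in> P.span (f ` D)"
        using less.hyps d_def P.span_zero by metis
      moreover have "r \<in> P.span (f ` D)"
        unfolding r_def using d by (intro P.span_scale P.span_base) simp
      ultimately show ?thesis using P.span_add[of "p - r" "f ` D" r] by simp
    qed
  qed
  ultimately have "card (f ` D) = P.dim V"
    using f(1) by (intro P.basis_card_eq_dim) auto
  moreover have "inj_on f D" by (rule inj_onI) (metis f(3))
  ultimately show ?thesis by (simp add: card_image D_def)
qed

text \<open>The index \<open>n\<close> is the highest degree possible for the product. The factor
  \<open>degree q\<close> lets the formula cover constant \<open>q\<close>, where the derivative is
  0.\<close>

lemma coeff_mult_pderiv: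
  fixes p q :: "'k::field_char_0 poly"
  assumes "degree p + degree q = Suc n"
  shows "coeff (p * pderiv q) n = of_nat (degree q) * (lead_coeff p * lead_coeff q)"
    and "degree (p * pderiv q) \<le> n"
proof -
  have "coeff (p * pderiv q) n = of_nat (degree q) * (lead_coeff p * lead_coeff q) \<and>
      degree (p * pderiv q) \<le> n"
  proof (cases "degree q")
    case 0
    then show ?thesis by (simp add: pderiv_eq_0_iff[THEN iffD2])
  next
    case (Suc m)
    then have n: "n = degree p + degree (pderiv q)" using assms by (simp add: degree_pderiv)
    have "degree (pderiv q) = m" using Suc by (simp add: degree_pderiv)
    then have "lead_coeff (pderiv q) = of_nat (degree q) * lead_coeff q"
      by (simp add: coeff_pderiv Suc)
    then show ?thesis
      unfolding n by (simp add: coeff_mult_degree_sum degree_mult_le mult_ac)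
  qed
  then show "coeff (p * pderiv q) n = of_nat (degree q) * (lead_coeff p * lead_coeff q)"
    and "degree (p * pderiv q) \<le> n" by auto
qed

text \<open>The top coefficient is the product of the leading coefficients times the difference of
  the degrees, which is nonzero in characteristic 0.\<close>

lemma degree_wronskian:
  fixes p q :: "'k::field_char_0 poly"
  assumes "p \<noteq> 0" "q \<noteq> 0" "degree p \<noteq> degree q"
  shows "p * pderiv q - pderiv p * q \<noteq> 0"
    and "degree (p * pderiv q - pderiv p * q) = degree p + degree q - 1"
proof -
  obtain n where n: "degree p + degree q = Suc n" using assms(3) by (cases "degree p + degree q") auto
  then have n': "degree q + degree p = Suc n" by simp
  have "coeff (p * pderiv q - pderiv p * q) n =
      (of_nat (degree q) - of_nat (degree p)) * (lead_coeff p * lead_coeff q)"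
    using coeff_mult_pderiv(1)[OF n] coeff_mult_pderiv(1)[OF n']
    by (simp add: mult.commute[of "pderiv p"] algebra_simps)
  then have nz: "coeff (p * pderiv q - pderiv p * q) n \<noteq> 0"
    using assms by simp
  then show "p * pderiv q - pderiv p * q \<noteq> 0" by auto
  have "degree (p * pderiv q - pderiv p * q) \<le> n"
    using coeff_mult_pderiv(2)[OF n] coeff_mult_pderiv(2)[OF n']
    by (intro degree_diff_le) (simp_all add: mult.commute)
  then show "degree (p * pderiv q - pderiv p * q) = degree p + degree q - 1"
    using le_degree[OF nz] n by simp
qed

context crossed_product begin

text \<open>If \<open>a < b < M\<close> are the three degrees, then \<open>b + M - 1\<close> is a degree by
  \<open>degree_wronskian\<close>, so \<open>b \<le> 1\<close> and \<open>a = 0\<close>.\<close>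

lemma type3_surjective:
  assumes "vector_space.dim smult (range \<theta>) = 3"
  obtains X where "\<theta> X = 1"
proof -
  define D where "D = degree ` (range \<theta> - {0})"
  have "\<theta>.vs2.subspace (range \<theta>)" using \<theta>.subspace_image[OF lie.subspace_UNIV] .
  from poly_dim_eq_card_degrees[OF this] have card: "card D = 3"
    using assms by (simp add: D_def)
  then have fin: "finite D" by (metis card.infinite zero_neq_numeral)
  \<comment> \<open>The image of \<open>\<theta>\<close> is closed under the bracket of vector
    fields, which is the Wronskian.\<close>
  have step: "m + n - 1 \<in> D" if mn: "m \<in> D" "n \<in> D" "m \<noteq> n" for m n
  proof -
    obtain X Y where "\<theta> X \<noteq> 0" "\<theta> Y \<noteq> 0" "degree (\<theta> X) = m" "degree (\<theta> Y) = n"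
      using mn(1,2) by (auto simp: D_def)
    moreover have "\<theta> (bracket X Y) = \<theta> X * pderiv (\<theta> Y) - pderiv (\<theta> X) * \<theta> Y"
      using action unfolding lie_action_def by blast
    ultimately have "\<theta> (bracket X Y) \<noteq> 0" "degree (\<theta> (bracket X Y)) = m + n - 1"
      using degree_wronskian[of "\<theta> X" "\<theta> Y"] mn(3) by simp_all
    then show ?thesis unfolding D_def by (metis DiffI image_eqI rangeI singletonD)
  qed
  have D0: "D \<noteq> {}" using card by auto
  then have M: "Max D \<in> D" using fin by simp
  then have "card (D - {Max D}) = 2" using card by simp
  then obtain a b where ab: "D - {Max D} = {a, b}" "a < b"
    by (metis card_2_iff insert_commute linorder_neqE_nat)
  then have "b \<in> D" "a \<in> D" "b \<noteq> Max D" by blast+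
  then have "b + Max D - 1 \<le> Max D" using step[OF _ M] fin by simp
  moreover have "b \<le> Max D" using \<open>b \<in> D\<close> fin by simp
  ultimately have "a = 0" using ab(2) \<open>b \<noteq> Max D\<close> by linarith
  then obtain X where X: "\<theta> X \<noteq> 0" "degree (\<theta> X) = 0" using \<open>a \<in> D\<close>
    unfolding D_def by (smt (verit) DiffE imageE insertCI)
  then obtain c where c: "\<theta> X = [:c:]" "c \<noteq> 0" by (metis degree_eq_zeroE pCons_0_0)
  then have "\<theta> (scl (1 / c) X) = 1" by (simp add: \<theta>.scale one_pCons)
  then show ?thesis by (rule that)
qed

text \<open>Turns the dimension of the image into the lower bound on the rank that
  \<open>wedge_gen_eq_0\<close> requires.\<close>

lemma dim_range_le: "vector_space.dim smult (range \<theta>) \<le> card (UNIV :: 'i set)"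
proof -
  have "\<theta> X \<in> \<theta>.vs2.span (range (\<lambda>i. \<theta> (e i)))" for X
  proof -
    have "(\<Sum>i\<in>UNIV. smult (coord X i) (\<theta> (e i))) \<in> \<theta>.vs2.span (range (\<lambda>i. \<theta> (e i)))"
      by (intro \<theta>.vs2.span_sum \<theta>.vs2.span_scale \<theta>.vs2.span_base) simp
    then show ?thesis by (subst expand[of X, symmetric]) (simp only: \<theta>.sum \<theta>.scale)
  qed
  then have "\<theta>.vs2.dim (range \<theta>) \<le> card (range (\<lambda>i. \<theta> (e i)))"
    by (intro \<theta>.vs2.dim_le_card) auto
  also have "\<dots> \<le> card (UNIV :: 'i set)" by (rule card_image_le) simp
  finally show ?thesis .
qed

end

theorem theorem3p5:
  fixes scl :: "'k::real_or_complex \<Rightarrow> 'g::ab_group_add \<Rightarrow> 'g"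
    and bracket :: "'g \<Rightarrow> 'g \<Rightarrow> 'g"
    and e :: "'i::{finite,linorder} \<Rightarrow> 'g"
    and \<theta> :: "'g \<Rightarrow> 'k poly"
  assumes "lie_algebra scl bracket"
    and "ordered_basis scl e"
    and "type3_action scl bracket \<theta>"
  shows "equiv (compatible_pairs scl bracket e \<theta>) (pair_equiv scl bracket e \<theta>) \<and>
    (\<exists>\<Phi>. bij_betw \<Phi> (compatible_pairs scl bracket e \<theta> // pair_equiv scl bracket e \<theta>)
            {\<sigma>. crossed_bialgebra scl bracket e \<theta> \<sigma>} \<and>
         (\<forall>C\<in>compatible_pairs scl bracket e \<theta> // pair_equiv scl bracket e \<theta>.
           \<forall>(\<Lambda>, \<Omega>)\<in>C.
             \<Phi> C = (\<lambda>x. crossed_schouten scl bracket e \<theta> \<Lambda> x + extend e \<Omega> x)))"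
proof -
  interpret crossed_product scl bracket e \<theta>
    using assms by (intro crossed_product.intro) (simp_all add: type3_action_def)
  let ?A = "compatible_pairs scl bracket e \<theta>" and ?F = "\<lambda>(\<Lambda>, \<Omega>). pair_differential \<Lambda> \<Omega>"
  have dim: "vector_space.dim smult (range \<theta>) = 3" using assms(3) by (simp add: type3_action_def)
  then have card: "3 \<le> card (UNIV :: 'i set)" using dim_range_le by simp
  obtain X where "\<theta> X = 1" using type3_surjective[OF dim] .
  then have x0: "anchor_poly e \<theta> (T X) = 1" by (simp add: anchor_poly_T)
  have "pair_equiv scl bracket e \<theta> \<subseteq> ?A \<times> ?A"
    unfolding pair_equiv_def by auto
  then have r: "pair_equiv scl bracket e \<theta> = {(x, y). x \<in> ?A \<and> y \<in> ?A \<and> ?F x = ?F y}"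
    using pair_equiv_iff[OF x0] by (auto 0 3)
  \<comment> \<open>The rank bound gives the inclusion from left to right, the element of anchor 1
    the converse.\<close>
  have image: "?F ` ?A = {\<sigma>. crossed_bialgebra scl bracket e \<theta> \<sigma>}"
    using compatible_crossed_bialgebra[OF _ card] crossed_bialgebra_compatible[OF x0] by force
  have "?F (\<Lambda>, \<Omega>) = (\<lambda>x. crossed_schouten scl bracket e \<theta> \<Lambda> x + extend e \<Omega> x)" for \<Lambda> \<Omega>
    by (simp add: pair_differential_def crossed_schouten_eq fun_eq_iff)
  moreover obtain \<Phi> where \<Phi>: "bij_betw \<Phi> (?A // pair_equiv scl bracket e \<theta>) (?F ` ?A)"
    "\<And>C x. C \<in> ?A // pair_equiv scl bracket e \<theta> \<Longrightarrow> x \<in> C \<Longrightarrow> \<Phi> C = ?F x"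
    using equiv_kernel(2)[OF r] by blast
  ultimately show ?thesis
    using equiv_kernel(1)[OF r] \<Phi>(1)[unfolded image] by (intro conjI exI[of _ \<Phi>]) auto
qed

end
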